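(* Let $X$ be a simple, connected, $3$-edge-connected graph and let $G\leq\mathrm{Aut}(X)$ be a subgroup acting semiregularly both on darts and on vertices of $X$. Then the subgroup $\Theta(G)$ of $\mathrm{Aut}(\mathrm{Jac}(X))$ is isomorphic to $G$.
   Context: A graph is a triple $(D;\sim,\lambda)$: $D$ a finite nonempty set of darts, $\sim$ an equivalence on $D$ whose classes are vertices, $\lambda$ an involution on $D$ (write $x^{-1}=\lambda(x)$) whose orbits are edges; $I(x)$ is the class of $x$. Simple means no loops, no semiedges ($x=x^{-1}$) and no parallel edges. An automorphism is a permutation $f$ of $D$ with $x\sim y\Rightarrow f(x)\sim f(y)$ and $\lambda f=f\lambda$. For an abelian group $A$, an $A$-flow is a map $\nu\colon D\to A$ with $\nu(x^{-1})=-\nu(x)$ whose values generate $A$; it is harmonic if $\sum_{y\sim x}\nu(y)=0$ for every dart $x$ and the sum of $\nu$ over every oriented cycle is $0$. The Jacobian $\mathrm{Jac}(X)$ is the maximal abelian group admitting a harmonic flow (equivalently the free abelian group on a set $D^+$ of one dart per edge modulo the cycle sums and vertex sums); its order equals the number of spanning trees of $X$. Fix a harmonic flow $\xi\colon D\to\mathrm{Jac}(X)$. The homomorphism $\Theta\colon\mathrm{Aut}(X)\to\mathrm{Aut}(\mathrm{Jac}(X))$ sends $f$ to the automorphism $f^*$ given by $f^*\big(\sum_{x}c_x\xi(x)\big)=\sum_x c_x\xi(f(x))$. *)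

theory Defs
  imports "HOL-Algebra.Group_Action" "HOL-Algebra.Free_Abelian_Groups"
begin

section \<open>Graphs as sets of darts\<close>

record 'a dart_graph =
  darts :: "'a set"
  same_vertex :: "('a \<times> 'a) set"
  rev_dart :: "'a \<Rightarrow> 'a"

locale dart_graph =
  fixes \<Gamma> :: "'a dart_graph"
  assumes finite_darts: "finite (darts \<Gamma>)"
    and darts_nonempty: "darts \<Gamma> \<noteq> {}"
    and equiv_same_vertex: "equiv (darts \<Gamma>) (same_vertex \<Gamma>)"
    and rev_dart_closed: "x \<in> darts \<Gamma> \<Longrightarrow> rev_dart \<Gamma> x \<in> darts \<Gamma>"
    and rev_rev_dart: "x \<in> darts \<Gamma> \<Longrightarrow> rev_dart \<Gamma> (rev_dart \<Gamma> x) = x"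

definition initial_vertex :: "'a dart_graph \<Rightarrow> 'a \<Rightarrow> 'a set" where
  "initial_vertex \<Gamma> x = same_vertex \<Gamma> `` {x}"

definition vertices :: "'a dart_graph \<Rightarrow> 'a set set" where
  "vertices \<Gamma> = darts \<Gamma> // same_vertex \<Gamma>"

definition edge_of :: "'a dart_graph \<Rightarrow> 'a \<Rightarrow> 'a set" where
  "edge_of \<Gamma> x = {x, rev_dart \<Gamma> x}"

definition edges :: "'a dart_graph \<Rightarrow> 'a set set" where
  "edges \<Gamma> = edge_of \<Gamma> ` darts \<Gamma>"

definition semiedge :: "'a dart_graph \<Rightarrow> 'a \<Rightarrow> bool" where
  "semiedge \<Gamma> x \<longleftrightarrow> rev_dart \<Gamma> x = x"

definition loop :: "'a dart_graph \<Rightarrow> 'a \<Rightarrow> bool" where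
  "loop \<Gamma> x \<longleftrightarrow>
     \<not> semiedge \<Gamma> x \<and> initial_vertex \<Gamma> x = initial_vertex \<Gamma> (rev_dart \<Gamma> x)"

text \<open>Two different edges with the same end-vertices can always be directed in parallel.\<close>

definition parallel :: "'a dart_graph \<Rightarrow> 'a \<Rightarrow> 'a \<Rightarrow> bool" where
  "parallel \<Gamma> x y \<longleftrightarrow>
     edge_of \<Gamma> x \<noteq> edge_of \<Gamma> y \<and>
     initial_vertex \<Gamma> x = initial_vertex \<Gamma> y \<and>
     initial_vertex \<Gamma> (rev_dart \<Gamma> x) = initial_vertex \<Gamma> (rev_dart \<Gamma> y)"

definition simple_graph :: "'a dart_graph \<Rightarrow> bool" where
  "simple_graph \<Gamma> \<longleftrightarrow>
     (\<forall>x\<in>darts \<Gamma>. \<not> loop \<Gamma> x \<and> \<not> semiedge \<Gamma> x) \<and>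
     (\<forall>x\<in>darts \<Gamma>. \<forall>y\<in>darts \<Gamma>. \<not> parallel \<Gamma> x y)"

text \<open>Deleting a set of edges keeps all vertices, including those that become isolated; this is why
  deletion is expressed by restricting adjacency instead of the set of darts.\<close>

definition adjacent_without :: "'a dart_graph \<Rightarrow> 'a set set \<Rightarrow> ('a set \<times> 'a set) set" where
  "adjacent_without \<Gamma> F =
     {(initial_vertex \<Gamma> x, initial_vertex \<Gamma> (rev_dart \<Gamma> x)) | x. x \<in> darts \<Gamma> \<and> edge_of \<Gamma> x \<notin> F}"

definition connected_without :: "'a dart_graph \<Rightarrow> 'a set set \<Rightarrow> bool" where
  "connected_without \<Gamma> F \<longleftrightarrow>
     (\<forall>u\<in>vertices \<Gamma>. \<forall>v\<in>vertices \<Gamma>. (u, v) \<in> (adjacent_without \<Gamma> F)\<^sup>*)"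

definition connected_graph :: "'a dart_graph \<Rightarrow> bool" where
  "connected_graph \<Gamma> \<longleftrightarrow> connected_without \<Gamma> {}"

definition edge_connected :: "nat \<Rightarrow> 'a dart_graph \<Rightarrow> bool" where
  "edge_connected k \<Gamma> \<longleftrightarrow> (\<forall>F\<subseteq>edges \<Gamma>. card F < k \<longrightarrow> connected_without \<Gamma> F)"

text \<open>The last condition excludes semiedges and traversing an edge back and forth; loops and
  pairs of parallel edges do give cycles.\<close>

definition oriented_cycle :: "'a dart_graph \<Rightarrow> 'a list \<Rightarrow> bool" where
  "oriented_cycle \<Gamma> c \<longleftrightarrow>
     c \<noteq> [] \<and> set c \<subseteq> darts \<Gamma> \<and>
     (\<forall>i<length c. initial_vertex \<Gamma> (rev_dart \<Gamma> (c ! i)) =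
                     initial_vertex \<Gamma> (c ! (Suc i mod length c))) \<and>
     distinct (map (initial_vertex \<Gamma>) c) \<and>
     (\<forall>x\<in>set c. rev_dart \<Gamma> x \<notin> set c)"

section \<open>Automorphisms and semiregular actions\<close>

definition graph_auto :: "'a dart_graph \<Rightarrow> ('a \<Rightarrow> 'a) set" where
  "graph_auto \<Gamma> =
     {f \<in> Bij (darts \<Gamma>).
        (\<forall>x\<in>darts \<Gamma>. \<forall>y\<in>darts \<Gamma>. (x, y) \<in> same_vertex \<Gamma> \<longrightarrow> (f x, f y) \<in> same_vertex \<Gamma>) \<and>
        (\<forall>x\<in>darts \<Gamma>. f (rev_dart \<Gamma> x) = rev_dart \<Gamma> (f x))}"

definition GraphAutoGroup :: "'a dart_graph \<Rightarrow> ('a \<Rightarrow> 'a) monoid" where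
  "GraphAutoGroup \<Gamma> = BijGroup (darts \<Gamma>) \<lparr>carrier := graph_auto \<Gamma>\<rparr>"

definition dart_action :: "('a \<Rightarrow> 'a) \<Rightarrow> 'a \<Rightarrow> 'a" where
  "dart_action f = f"

definition vertex_action :: "'a dart_graph \<Rightarrow> ('a \<Rightarrow> 'a) \<Rightarrow> 'a set \<Rightarrow> 'a set" where
  "vertex_action \<Gamma> f = (\<lambda>v\<in>vertices \<Gamma>. f ` v)"

definition semiregular :: "('g, 'm) monoid_scheme \<Rightarrow> 'b set \<Rightarrow> ('g \<Rightarrow> 'b \<Rightarrow> 'b) \<Rightarrow> bool" where
  "semiregular G E \<phi> \<longleftrightarrow> (\<forall>x\<in>E. stabilizer G \<phi> x = {\<one>\<^bsub>G\<^esub>})"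

section \<open>Harmonic flows\<close>

text \<open>Abelian groups are written multiplicatively, as in \<^theory>\<open>HOL-Algebra.Group\<close>. The
  darts of an oriented cycle are distinct, so a cycle sum is a product over a set.\<close>

definition flow :: "'a dart_graph \<Rightarrow> ('b, 'm) monoid_scheme \<Rightarrow> ('a \<Rightarrow> 'b) \<Rightarrow> bool" where
  "flow \<Gamma> A \<nu> \<longleftrightarrow>
     \<nu> \<in> darts \<Gamma> \<rightarrow> carrier A \<and>
     (\<forall>x\<in>darts \<Gamma>. \<nu> (rev_dart \<Gamma> x) = inv\<^bsub>A\<^esub> (\<nu> x)) \<and>
     generate A (\<nu> ` darts \<Gamma>) = carrier A"

definition harmonic_flow :: "'a dart_graph \<Rightarrow> ('b, 'm) monoid_scheme \<Rightarrow> ('a \<Rightarrow> 'b) \<Rightarrow> bool" where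
  "harmonic_flow \<Gamma> A \<nu> \<longleftrightarrow>
     flow \<Gamma> A \<nu> \<and>
     (\<forall>x\<in>darts \<Gamma>. finprod A \<nu> (initial_vertex \<Gamma> x) = \<one>\<^bsub>A\<^esub>) \<and>
     (\<forall>c. oriented_cycle \<Gamma> c \<longrightarrow> finprod A \<nu> (set c) = \<one>\<^bsub>A\<^esub>)"

section \<open>The Jacobian\<close>

text \<open>A set \<open>P\<close> consisting of one dart per edge.\<close>

definition orientation :: "'a dart_graph \<Rightarrow> 'a set \<Rightarrow> bool" where
  "orientation \<Gamma> P \<longleftrightarrow> P \<subseteq> darts \<Gamma> \<and> (\<forall>e\<in>edges \<Gamma>. \<exists>!x. x \<in> P \<inter> e)"

text \<open>The darts outside \<open>P\<close> are interpreted by \<open>x\<^sup>-\<^sup>1 = - x\<close>.\<close>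

definition dart_elem :: "'a dart_graph \<Rightarrow> 'a set \<Rightarrow> 'a \<Rightarrow> ('a \<Rightarrow>\<^sub>0 int)" where
  "dart_elem \<Gamma> P x = (if x \<in> P then frag_of x else - frag_of (rev_dart \<Gamma> x))"

definition jac_relators :: "'a dart_graph \<Rightarrow> 'a set \<Rightarrow> ('a \<Rightarrow>\<^sub>0 int) set" where
  "jac_relators \<Gamma> P =
     {(\<Sum>x\<in>set c. dart_elem \<Gamma> P x) | c. oriented_cycle \<Gamma> c} \<union>
     {(\<Sum>y\<in>v. dart_elem \<Gamma> P y) | v. v \<in> vertices \<Gamma>}"

definition jac_subgroup :: "'a dart_graph \<Rightarrow> 'a set \<Rightarrow> ('a \<Rightarrow>\<^sub>0 int) set" where
  "jac_subgroup \<Gamma> P = generate (free_Abelian_group P) (jac_relators \<Gamma> P)"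

definition Jac :: "'a dart_graph \<Rightarrow> 'a set \<Rightarrow> ('a \<Rightarrow>\<^sub>0 int) set monoid" where
  "Jac \<Gamma> P = free_Abelian_group P Mod jac_subgroup \<Gamma> P"

definition canonical_flow :: "'a dart_graph \<Rightarrow> 'a set \<Rightarrow> 'a \<Rightarrow> ('a \<Rightarrow>\<^sub>0 int) set" where
  "canonical_flow \<Gamma> P x = jac_subgroup \<Gamma> P #>\<^bsub>free_Abelian_group P\<^esub> dart_elem \<Gamma> P x"

text \<open>\<open>Jac \<Gamma> P\<close> is the largest abelian group admitting a harmonic flow: its canonical flow is
  harmonic, and every harmonic flow factors through it by an epimorphism.\<close>

lemma (in dart_graph) dart_elem_in_carrier:
  assumes "orientation \<Gamma> P" "x \<in> darts \<Gamma>"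
  shows "dart_elem \<Gamma> P x \<in> carrier (free_Abelian_group P)"
proof -
  have "x \<in> P \<or> rev_dart \<Gamma> x \<in> P"
    using assms by (force simp: orientation_def edges_def edge_of_def)
  then show ?thesis
    by (auto simp: dart_elem_def)
qed

lemma (in dart_graph) initial_vertex_eq:
  assumes "x \<in> darts \<Gamma>" "y \<in> darts \<Gamma>"
  shows "initial_vertex \<Gamma> x = initial_vertex \<Gamma> y \<longleftrightarrow> (x, y) \<in> same_vertex \<Gamma>"
  using assms equiv_same_vertex by (simp add: initial_vertex_def eq_equiv_class_iff)

lemma (in dart_graph) initial_vertex_in_vertices:
  "x \<in> darts \<Gamma> \<Longrightarrow> initial_vertex \<Gamma> x \<in> vertices \<Gamma>"
  by (simp add: initial_vertex_def vertices_def quotientI)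

lemma (in dart_graph) vertices_subset: "v \<in> vertices \<Gamma> \<Longrightarrow> v \<subseteq> darts \<Gamma>"
  using equiv_same_vertex unfolding vertices_def by (rule in_quotient_imp_subset)

lemma (in dart_graph) jac_relators_subset:
  assumes "orientation \<Gamma> P"
  shows "jac_relators \<Gamma> P \<subseteq> carrier (free_Abelian_group P)"
proof -
  have "(\<Sum>x\<in>S. dart_elem \<Gamma> P x) \<in> carrier (free_Abelian_group P)" if "S \<subseteq> darts \<Gamma>" for S
    using that dart_elem_in_carrier[OF assms] by (intro sum_closed_free_Abelian_group) blast
  then show ?thesis
    using vertices_subset unfolding jac_relators_def oriented_cycle_def by blast
qed

lemma (in dart_graph) normal_jac_subgroup:
  assumes "orientation \<Gamma> P"
  shows "jac_subgroup \<Gamma> P \<lhd> free_Abelian_group P"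
proof -
  interpret F: comm_group "free_Abelian_group P" by (rule abelian_free_Abelian_group)
  show ?thesis
    unfolding jac_subgroup_def
    by (intro F.subgroup_imp_normal F.generate_is_subgroup jac_relators_subset assms)
qed

lemma (in dart_graph) comm_group_Jac:
  assumes "orientation \<Gamma> P"
  shows "comm_group (Jac \<Gamma> P)"
proof -
  interpret F: comm_group "free_Abelian_group P" by (rule abelian_free_Abelian_group)
  show ?thesis
    unfolding Jac_def
    by (intro F.abelian_FactGroup normal_imp_subgroup normal_jac_subgroup assms)
qed

lemma (in comm_group) finprod_free_Abelian_hom:
  assumes h: "h \<in> hom (free_Abelian_group P) G"
    and "finite S" "f \<in> S \<rightarrow> carrier (free_Abelian_group P)"
  shows "finprod G (h \<circ> f) S = h (\<Sum>x\<in>S. f x)"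
  using assms(2,3)
proof (induction S)
  case empty
  show ?case
    using hom_one[OF h group_free_Abelian_group group_axioms] by simp
next
  case (insert a S)
  have m: "h (x + y) = h x \<otimes> h y"
    if "x \<in> carrier (free_Abelian_group P)" "y \<in> carrier (free_Abelian_group P)" for x y
    using hom_mult[OF h that] by simp
  have c: "h \<circ> f \<in> insert a S \<rightarrow> carrier G"
    using insert.prems hom_in_carrier[OF h]
    by (auto simp: Pi_iff simp del: carrier_free_Abelian_group_iff)
  have fS: "f \<in> S \<rightarrow> carrier (free_Abelian_group P)"
    using insert.prems by blast
  then have s: "(\<Sum>x\<in>S. f x) \<in> carrier (free_Abelian_group P)"
    by (intro sum_closed_free_Abelian_group) blast
  show ?case
    using insert fS c s m by (simp add: Pi_iff del: carrier_free_Abelian_group_iff)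
qed

lemma (in dart_graph) harmonic_canonical_flow:
  assumes P: "orientation \<Gamma> P" and ns: "\<And>x. x \<in> darts \<Gamma> \<Longrightarrow> \<not> semiedge \<Gamma> x"
  shows "harmonic_flow \<Gamma> (Jac \<Gamma> P) (canonical_flow \<Gamma> P)"
proof -
  let ?F = "free_Abelian_group P"
  let ?N = "jac_subgroup \<Gamma> P"
  let ?q = "\<lambda>a. ?N #>\<^bsub>?F\<^esub> a"
  interpret F: comm_group ?F by (rule abelian_free_Abelian_group)
  interpret J: comm_group "Jac \<Gamma> P" by (rule comm_group_Jac[OF P])
  interpret N: normal ?N ?F by (rule normal_jac_subgroup[OF P])
  have q: "?q \<in> hom ?F (Jac \<Gamma> P)"
    unfolding Jac_def by (rule N.r_coset_hom_Mod)
  interpret q: group_hom ?F "Jac \<Gamma> P" ?q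
    by unfold_locales (rule q)
  have can: "canonical_flow \<Gamma> P = ?q \<circ> dart_elem \<Gamma> P"
    by (simp add: fun_eq_iff canonical_flow_def)
  have dc: "dart_elem \<Gamma> P x \<in> carrier ?F" if "x \<in> darts \<Gamma>" for x
    using dart_elem_in_carrier[OF P that] .
  have mapsto: "canonical_flow \<Gamma> P \<in> darts \<Gamma> \<rightarrow> carrier (Jac \<Gamma> P)"
    using dc q.hom_closed by (auto simp: can simp del: carrier_free_Abelian_group_iff)
  have neg: "dart_elem \<Gamma> P (rev_dart \<Gamma> x) = - dart_elem \<Gamma> P x" if x: "x \<in> darts \<Gamma>" for x
  proof -
    have "edge_of \<Gamma> x \<in> edges \<Gamma>" using x by (simp add: edges_def)
    then have "\<exists>!y. y \<in> P \<inter> edge_of \<Gamma> x"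
      using P unfolding orientation_def by metis
    then obtain y where y: "y \<in> P" "y \<in> {x, rev_dart \<Gamma> x}"
        and uniq: "\<And>z. z \<in> P \<Longrightarrow> z \<in> {x, rev_dart \<Gamma> x} \<Longrightarrow> z = y"
      unfolding edge_of_def by blast
    have ne: "rev_dart \<Gamma> x \<noteq> x" using ns[OF x] by (simp add: semiedge_def)
    have "x \<in> P \<longleftrightarrow> rev_dart \<Gamma> x \<notin> P"
      using y uniq[of x] uniq[of "rev_dart \<Gamma> x"] ne by (metis insert_iff singletonD)
    then show ?thesis
      using rev_rev_dart[OF x] by (simp add: dart_elem_def)
  qed
  have inv: "canonical_flow \<Gamma> P (rev_dart \<Gamma> x) = inv\<^bsub>Jac \<Gamma> P\<^esub> (canonical_flow \<Gamma> P x)"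
    if x: "x \<in> darts \<Gamma>" for x
    using q.hom_inv[OF dc[OF x]] dc[OF x] by (simp add: can neg[OF x])
  have zero: "finprod (Jac \<Gamma> P) (canonical_flow \<Gamma> P) S = \<one>\<^bsub>Jac \<Gamma> P\<^esub>"
    if S: "S \<subseteq> darts \<Gamma>" and r: "(\<Sum>x\<in>S. dart_elem \<Gamma> P x) \<in> jac_relators \<Gamma> P" for S
  proof -
    have "finite S" using S finite_darts finite_subset by blast
    then have "finprod (Jac \<Gamma> P) (canonical_flow \<Gamma> P) S = ?q (\<Sum>x\<in>S. dart_elem \<Gamma> P x)"
      unfolding can using S dc by (intro J.finprod_free_Abelian_hom[OF q]) auto
    also have "\<dots> = ?N"
      using r by (intro F.coset_join2 N.subgroup_axioms)
        (use jac_relators_subset[OF P] in \<open>auto simp: jac_subgroup_def intro: generate.incl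
          simp del: carrier_free_Abelian_group_iff\<close>)
    finally show ?thesis by (simp add: Jac_def)
  qed
  have "carrier (Jac \<Gamma> P) \<subseteq> generate (Jac \<Gamma> P) (canonical_flow \<Gamma> P ` darts \<Gamma>)"
  proof
    fix y assume "y \<in> carrier (Jac \<Gamma> P)"
    then obtain a where a: "Poly_Mapping.keys a \<subseteq> P" and y: "y = ?q a"
      by (auto simp: Jac_def carrier_FactGroup)
    have sub: "subgroup (generate (Jac \<Gamma> P) (canonical_flow \<Gamma> P ` darts \<Gamma>)) (Jac \<Gamma> P)"
      using mapsto by (intro J.generate_is_subgroup) auto
    have "?q a \<in> generate (Jac \<Gamma> P) (canonical_flow \<Gamma> P ` darts \<Gamma>)"
      using a
    proof (rule free_Abelian_group_induct)
      show "?q 0 \<in> generate (Jac \<Gamma> P) (canonical_flow \<Gamma> P ` darts \<Gamma>)"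
        using q.hom_one subgroup.one_closed[OF sub] by simp
    next
      fix a b
      assume ab: "Poly_Mapping.keys a \<subseteq> P" "Poly_Mapping.keys b \<subseteq> P"
        and IH: "?q a \<in> generate (Jac \<Gamma> P) (canonical_flow \<Gamma> P ` darts \<Gamma>)"
          "?q b \<in> generate (Jac \<Gamma> P) (canonical_flow \<Gamma> P ` darts \<Gamma>)"
      have "?q (a - b) = ?q a \<otimes>\<^bsub>Jac \<Gamma> P\<^esub> inv\<^bsub>Jac \<Gamma> P\<^esub> ?q b"
        using ab q.hom_mult[of a "- b"] q.hom_inv[of b] by simp
      then show "?q (a - b) \<in> generate (Jac \<Gamma> P) (canonical_flow \<Gamma> P ` darts \<Gamma>)"
        using IH subgroup.m_closed[OF sub] subgroup.m_inv_closed[OF sub] by simp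
    next
      fix x assume "x \<in> P"
      then have "x \<in> darts \<Gamma>" "?q (frag_of x) = canonical_flow \<Gamma> P x"
        using P by (auto simp: orientation_def canonical_flow_def dart_elem_def)
      then show "?q (frag_of x) \<in> generate (Jac \<Gamma> P) (canonical_flow \<Gamma> P ` darts \<Gamma>)"
        by (simp add: generate.incl)
    qed
    then show "y \<in> generate (Jac \<Gamma> P) (canonical_flow \<Gamma> P ` darts \<Gamma>)" using y by simp
  qed
  moreover have "generate (Jac \<Gamma> P) (canonical_flow \<Gamma> P ` darts \<Gamma>) \<subseteq> carrier (Jac \<Gamma> P)"
    using mapsto by (intro J.generate_incl) auto
  ultimately have "flow \<Gamma> (Jac \<Gamma> P) (canonical_flow \<Gamma> P)"
    using mapsto inv unfolding flow_def by blast
  moreover have "finprod (Jac \<Gamma> P) (canonical_flow \<Gamma> P) v = \<one>\<^bsub>Jac \<Gamma> P\<^esub>"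
    if "v \<in> vertices \<Gamma>" for v
    using that by (intro zero vertices_subset) (auto simp: jac_relators_def)
  moreover have "finprod (Jac \<Gamma> P) (canonical_flow \<Gamma> P) (set c) = \<one>\<^bsub>Jac \<Gamma> P\<^esub>"
    if "oriented_cycle \<Gamma> c" for c
    using that by (intro zero) (auto simp: jac_relators_def oriented_cycle_def)
  ultimately show ?thesis
    using initial_vertex_in_vertices unfolding harmonic_flow_def by blast
qed

lemma (in dart_graph) harmonic_flow_factors:
  assumes A: "comm_group A" and P: "orientation \<Gamma> P" and \<nu>: "harmonic_flow \<Gamma> A \<nu>"
  obtains h where "h \<in> epi (Jac \<Gamma> P) A"
    "\<And>x. x \<in> darts \<Gamma> \<Longrightarrow> h (canonical_flow \<Gamma> P x) = \<nu> x"
proof -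
  let ?F = "free_Abelian_group P"
  let ?N = "jac_subgroup \<Gamma> P"
  interpret A: comm_group A by fact
  interpret F: comm_group ?F by (rule abelian_free_Abelian_group)
  have mapsto: "\<nu> \<in> darts \<Gamma> \<rightarrow> carrier A"
    and inv: "\<And>x. x \<in> darts \<Gamma> \<Longrightarrow> \<nu> (rev_dart \<Gamma> x) = inv\<^bsub>A\<^esub> (\<nu> x)"
    and gen: "generate A (\<nu> ` darts \<Gamma>) = carrier A"
    using \<nu> by (auto simp: harmonic_flow_def flow_def)
  have "P \<subseteq> darts \<Gamma>" using P by (simp add: orientation_def)
  then have "\<nu> ` P \<subseteq> carrier A" using mapsto by auto
  then obtain g where g: "g \<in> hom ?F A" and gf: "\<And>x. x \<in> P \<Longrightarrow> g (frag_of x) = \<nu> x"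
    using A.free_Abelian_group_universal by metis
  interpret g: group_hom ?F A g
    by unfold_locales (rule g)
  have gd: "g (dart_elem \<Gamma> P x) = \<nu> x" if x: "x \<in> darts \<Gamma>" for x
  proof (cases "x \<in> P")
    case False
    then have r: "rev_dart \<Gamma> x \<in> P"
      using P x by (force simp: orientation_def edges_def edge_of_def)
    have "g (- frag_of (rev_dart \<Gamma> x)) = inv\<^bsub>A\<^esub> \<nu> (rev_dart \<Gamma> x)"
      using g.hom_inv[of "frag_of (rev_dart \<Gamma> x)"] r by (simp add: gf)
    also have "\<dots> = \<nu> x"
      using inv[OF x] mapsto x by (auto simp: Pi_iff)
    finally show ?thesis using False by (simp add: dart_elem_def)
  qed (simp add: dart_elem_def gf)
  have ker: "g (\<Sum>x\<in>S. dart_elem \<Gamma> P x) = finprod A \<nu> S" if S: "S \<subseteq> darts \<Gamma>" for S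
  proof -
    have "g (\<Sum>x\<in>S. dart_elem \<Gamma> P x) = finprod A (g \<circ> dart_elem \<Gamma> P) S"
      using S dart_elem_in_carrier[OF P] finite_subset[OF S finite_darts]
      by (intro A.finprod_free_Abelian_hom[OF g, symmetric]) auto
    also have "\<dots> = finprod A \<nu> S"
      using S gd mapsto by (intro A.finprod_cong') auto
    finally show ?thesis .
  qed
  have "jac_relators \<Gamma> P \<subseteq> kernel ?F A g"
  proof
    fix a assume a: "a \<in> jac_relators \<Gamma> P"
    then have "g a = \<one>\<^bsub>A\<^esub>"
      unfolding jac_relators_def
    proof (elim UnE CollectE exE conjE)
      fix c assume "a = (\<Sum>x\<in>set c. dart_elem \<Gamma> P x)" "oriented_cycle \<Gamma> c"
      then show ?thesis
        using ker[of "set c"] \<nu> by (simp add: oriented_cycle_def harmonic_flow_def)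
    next
      fix v assume av: "a = (\<Sum>y\<in>v. dart_elem \<Gamma> P y)" and v: "v \<in> vertices \<Gamma>"
      then obtain x where "x \<in> darts \<Gamma>" "v = initial_vertex \<Gamma> x"
        by (auto simp: vertices_def initial_vertex_def elim: quotientE)
      then show ?thesis
        using ker[OF vertices_subset[OF v]] \<nu> av by (simp add: harmonic_flow_def)
    qed
    then show "a \<in> kernel ?F A g"
      using a jac_relators_subset[OF P] unfolding kernel_def by blast
  qed
  then have "?N \<subseteq> kernel ?F A g"
    unfolding jac_subgroup_def by (rule F.generate_subgroup_incl) (rule g.subgroup_kernel)
  then obtain h where h: "h \<in> hom (?F Mod ?N) A"
    and hg: "\<And>a. a \<in> carrier ?F \<Longrightarrow> h (?N #>\<^bsub>?F\<^esub> a) = g a"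
    using g.FactGroup_universal_kernel[OF normal_jac_subgroup[OF P]] by metis
  have hc: "h (canonical_flow \<Gamma> P x) = \<nu> x" if "x \<in> darts \<Gamma>" for x
    using hg dart_elem_in_carrier[OF P that] gd[OF that] by (simp add: canonical_flow_def)
  interpret J: comm_group "Jac \<Gamma> P" by (rule comm_group_Jac[OF P])
  interpret h: group_hom "Jac \<Gamma> P" A h
    using h by unfold_locales (simp add: Jac_def)
  have "canonical_flow \<Gamma> P x \<in> carrier (Jac \<Gamma> P)" if "x \<in> darts \<Gamma>" for x
    using dart_elem_in_carrier[OF P that]
    by (auto simp: Jac_def canonical_flow_def carrier_FactGroup)
  then have "\<nu> ` darts \<Gamma> \<subseteq> h ` carrier (Jac \<Gamma> P)"
    using hc by force
  then have "carrier A \<subseteq> h ` carrier (Jac \<Gamma> P)"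
    using A.generate_subgroup_incl[OF _ h.img_is_subgroup] gen by metis
  then have "h \<in> epi (Jac \<Gamma> P) A"
    using h.homh h.hom_closed unfolding epi_def by blast
  then show thesis using that hc by blast
qed

section \<open>The induced action on the Jacobian\<close>

definition dart_combination ::
    "'a dart_graph \<Rightarrow> ('b, 'm) monoid_scheme \<Rightarrow> ('a \<Rightarrow> 'b) \<Rightarrow> ('a \<Rightarrow> int) \<Rightarrow> 'b" where
  "dart_combination \<Gamma> A \<nu> c = finprod A (\<lambda>x. \<nu> x [^]\<^bsub>A\<^esub> c x) (darts \<Gamma>)"

text \<open>The values of \<open>\<xi>\<close> generate \<open>A\<close> and members of \<^term>\<open>auto A\<close> are extensional, so at most one
  \<open>h\<close> has the stated property.\<close>

definition Theta ::
    "'a dart_graph \<Rightarrow> ('b, 'm) monoid_scheme \<Rightarrow> ('a \<Rightarrow> 'b) \<Rightarrow> ('a \<Rightarrow> 'a) \<Rightarrow> ('b \<Rightarrow> 'b)" where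
  "Theta \<Gamma> A \<xi> f =
     (THE h. h \<in> auto A \<and>
        (\<forall>c. h (dart_combination \<Gamma> A \<xi> c) = dart_combination \<Gamma> A (\<xi> \<circ> f) c))"

end

(* Every element of a group with a harmonic flow has a representing integer vector of least norm,
   whose sums over stars, cycles and edges are bounded, because adding or subtracting the indicator
   of such a set does not shorten it. An integer-valued harmonic flow is zero,
   since otherwise following positive darts produces a cycle with positive sum; so these sums
   determine the element and the group is finite. Hence every harmonic flow into Jac(X) is the
   canonical one up to an automorphism of Jac(X), which makes Theta a homomorphism. As X is simple and
   3-edge-connected, the flow is injective on darts (an argument of Baker and Norine), so Theta
   is injective. *)

theory Submission
  imports Defs
begin

section \<open>Integer combinations of flow values\<close>

text \<open>The flow \<open>\<xi>\<close> is an arbitrary harmonic flow, and the universal property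
  of the Jacobian gives only an epimorphism carrying the canonical flow to it. Finiteness is what
  makes this epimorphism invertible, and the pigeonhole argument supplies it without a determinant
  or a count of spanning trees. Injectivity on darts is proved in the language of divisors. The
  boundary of a dart is its initial vertex minus its terminal vertex. Cycles have boundary zero, and
  the boundary of a star is the Laplacian of the indicator of its vertex. So two darts with equal
  images have boundaries that differ by a principal divisor, that is, by the Laplacian of an integer
  function on the vertices, to which a maximum principle applies. The constant 3 is forced by the
  method and by the facts: if two edges form a cut, with darts e and f leaving the same side, then
  the stars on that side add up to the images of e and f, so e and the reverse of f have the same
  image.\<close>

lemma (in comm_group) finprod_inverse:
  assumes "f \<in> S \<rightarrow> carrier G"
  shows "finprod G (\<lambda>x. inv (f x)) S = inv (finprod G f S)"
proof (rule inv_equality[symmetric])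
  have "finprod G (\<lambda>x. inv (f x)) S \<otimes> finprod G f S = finprod G (\<lambda>x. inv (f x) \<otimes> f x) S"
    using assms by (intro finprod_multf[symmetric]) (auto simp: Pi_iff)
  also have "\<dots> = \<one>"
    using assms by (intro finprod_one_eqI) (auto simp: Pi_iff)
  finally show "finprod G (\<lambda>x. inv (f x)) S \<otimes> finprod G f S = \<one>" .
qed (use assms in \<open>auto simp: Pi_iff\<close>)

lemma (in group_hom) hom_finprod:
  assumes "comm_group G" "comm_group H" "f \<in> S \<rightarrow> carrier G"
  shows "h (finprod G f S) = finprod H (h \<circ> f) S"
proof -
  interpret G: comm_group G by fact
  interpret H: comm_group H by fact
  show ?thesis
    using assms(3)
  proof (induction S rule: infinite_finite_induct)
    case (insert a S)
    then have "h \<circ> f \<in> S \<rightarrow> carrier H" "h (f a) \<in> carrier H"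
      by (auto simp: Pi_iff)
    with insert show ?case by (simp add: Pi_iff)
  qed simp_all
qed

lemma flow_closed: "flow \<Gamma> A \<nu> \<Longrightarrow> x \<in> darts \<Gamma> \<Longrightarrow> \<nu> x \<in> carrier A"
  unfolding flow_def by blast

lemma dart_combination_cong:
  assumes "comm_group A" "\<And>x. x \<in> darts \<Gamma> \<Longrightarrow> \<nu> x \<in> carrier A"
    and "\<And>x. x \<in> darts \<Gamma> \<Longrightarrow> \<nu> x = \<mu> x" "\<And>x. x \<in> darts \<Gamma> \<Longrightarrow> c x = d x"
  shows "dart_combination \<Gamma> A \<nu> c = dart_combination \<Gamma> A \<mu> d"
proof -
  interpret A: comm_group A by fact
  show ?thesis
    unfolding dart_combination_def
  proof (rule A.finprod_cong')
    show "(\<lambda>x. \<mu> x [^]\<^bsub>A\<^esub> d x) \<in> darts \<Gamma> \<rightarrow> carrier A"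
    proof
      fix x assume "x \<in> darts \<Gamma>"
      then show "\<mu> x [^]\<^bsub>A\<^esub> d x \<in> carrier A"
        using assms(2,3)[of x] by simp
    qed
  qed (use assms in auto)
qed

lemma dart_combination_add:
  assumes "comm_group A" "\<And>x. x \<in> darts \<Gamma> \<Longrightarrow> \<nu> x \<in> carrier A"
  shows "dart_combination \<Gamma> A \<nu> (\<lambda>x. c x + d x) =
    dart_combination \<Gamma> A \<nu> c \<otimes>\<^bsub>A\<^esub> dart_combination \<Gamma> A \<nu> d"
proof -
  interpret A: comm_group A by fact
  have "dart_combination \<Gamma> A \<nu> (\<lambda>x. c x + d x) =
      finprod A (\<lambda>x. \<nu> x [^]\<^bsub>A\<^esub> c x \<otimes>\<^bsub>A\<^esub> \<nu> x [^]\<^bsub>A\<^esub> d x) (darts \<Gamma>)"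
    unfolding dart_combination_def
    using assms by (intro A.finprod_cong') (auto simp: A.int_pow_mult)
  then show ?thesis
    unfolding dart_combination_def using assms by (simp add: A.finprod_multf Pi_iff)
qed

lemma dart_combination_uminus:
  assumes "comm_group A" "\<And>x. x \<in> darts \<Gamma> \<Longrightarrow> \<nu> x \<in> carrier A"
  shows "dart_combination \<Gamma> A \<nu> (\<lambda>x. - c x) = inv\<^bsub>A\<^esub> dart_combination \<Gamma> A \<nu> c"
proof -
  interpret A: comm_group A by fact
  have "dart_combination \<Gamma> A \<nu> (\<lambda>x. - c x) = finprod A (\<lambda>x. inv\<^bsub>A\<^esub> (\<nu> x [^]\<^bsub>A\<^esub> c x)) (darts \<Gamma>)"
    unfolding dart_combination_def
    using assms by (intro A.finprod_cong') (auto simp: A.int_pow_neg)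
  then show ?thesis
    unfolding dart_combination_def using assms by (simp add: A.finprod_inverse Pi_iff)
qed

text \<open>This turns sets of darts into integer vectors: the indicator of a set with trivial
  product can be added to a vector without changing the element that the vector represents.\<close>

lemma (in dart_graph) dart_combination_of_bool:
  assumes "comm_group A" "\<And>x. x \<in> darts \<Gamma> \<Longrightarrow> \<nu> x \<in> carrier A" "S \<subseteq> darts \<Gamma>"
  shows "dart_combination \<Gamma> A \<nu> (\<lambda>x. of_bool (x \<in> S)) = finprod A \<nu> S"
proof -
  interpret A: comm_group A by fact
  show ?thesis
    unfolding dart_combination_def
    using assms finite_darts
    by (intro A.finprod_mono_neutral_cong_right) auto
qed

lemma (in dart_graph) ex_dart_combination:
  assumes "comm_group A" "flow \<Gamma> A \<nu>" "a \<in> carrier A"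
  obtains c where "a = dart_combination \<Gamma> A \<nu> c"
proof -
  interpret A: comm_group A by fact
  note cl = flow_closed[OF assms(2)]
  have single: "dart_combination \<Gamma> A \<nu> (\<lambda>x. of_bool (x \<in> {y})) = \<nu> y" if "y \<in> darts \<Gamma>" for y
    using that dart_combination_of_bool[OF assms(1) cl, where S = "{y}"] cl[of y] by simp
  have "a \<in> generate A (\<nu> ` darts \<Gamma>)"
    using assms by (simp add: flow_def)
  then have "\<exists>c. a = dart_combination \<Gamma> A \<nu> c"
  proof induction
    case one
    have "\<one>\<^bsub>A\<^esub> = dart_combination \<Gamma> A \<nu> (\<lambda>x. of_bool (x \<in> {}))"
      using dart_combination_of_bool[OF assms(1) cl, where S = "{}"] by simp
    then show ?case by blast
  next
    case (incl h)
    then obtain y where "y \<in> darts \<Gamma>" "h = \<nu> y" by auto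
    then have "h = dart_combination \<Gamma> A \<nu> (\<lambda>x. of_bool (x \<in> {y}))"
      using single[of y] by simp
    then show ?case by blast
  next
    case (inv h)
    then obtain y where "y \<in> darts \<Gamma>" "h = \<nu> y" by auto
    then have "inv\<^bsub>A\<^esub> h = dart_combination \<Gamma> A \<nu> (\<lambda>x. - of_bool (x \<in> {y}))"
      using single[of y] dart_combination_uminus[OF assms(1) cl, where c = "\<lambda>x. of_bool (x \<in> {y})"]
      by simp
    then show ?case by blast
  next
    case (eng h1 h2)
    then obtain c d where "h1 = dart_combination \<Gamma> A \<nu> c" "h2 = dart_combination \<Gamma> A \<nu> d"
      by blast
    then have "h1 \<otimes>\<^bsub>A\<^esub> h2 = dart_combination \<Gamma> A \<nu> (\<lambda>x. c x + d x)"
      by (simp add: dart_combination_add[OF assms(1) cl])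
    then show ?case by blast
  qed
  then show thesis using that by blast
qed

lemma dart_combination_hom:
  assumes "comm_group A" "comm_group B" "h \<in> hom A B"
    and "\<And>x. x \<in> darts \<Gamma> \<Longrightarrow> \<nu> x \<in> carrier A"
  shows "h (dart_combination \<Gamma> A \<nu> c) = dart_combination \<Gamma> B (h \<circ> \<nu>) c"
proof -
  interpret A: comm_group A by fact
  interpret B: comm_group B by fact
  interpret h: group_hom A B h by unfold_locales fact
  have "h (dart_combination \<Gamma> A \<nu> c) = finprod B (h \<circ> (\<lambda>x. \<nu> x [^]\<^bsub>A\<^esub> c x)) (darts \<Gamma>)"
    unfolding dart_combination_def using assms by (intro h.hom_finprod) auto
  also have "\<dots> = dart_combination \<Gamma> B (h \<circ> \<nu>) c"
    unfolding dart_combination_def using assms by (intro B.finprod_cong') (auto simp: h.hom_int_pow)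
  finally show ?thesis .
qed

section \<open>Groups with a harmonic flow are finite\<close>

text \<open>A walk that never leaves the finite set \<open>Q\<close> must revisit a vertex, and the
  stretch up to the first repetition is a cycle. The hypothesis \<open>rev\<close> supplies the ban
  on traversing an edge back and forth.\<close>

lemma (in dart_graph) oriented_cycle_in_closed_set:
  assumes Q: "Q \<subseteq> darts \<Gamma>" "x \<in> Q"
    and rev: "\<And>x. x \<in> Q \<Longrightarrow> rev_dart \<Gamma> x \<notin> Q"
    and suc: "\<And>x. x \<in> Q \<Longrightarrow> \<exists>y\<in>Q. initial_vertex \<Gamma> y = initial_vertex \<Gamma> (rev_dart \<Gamma> x)"
  obtains c where "oriented_cycle \<Gamma> c" "set c \<subseteq> Q"
proof -
  obtain s where s: "\<And>x. x \<in> Q \<Longrightarrow> s x \<in> Q"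
      "\<And>x. x \<in> Q \<Longrightarrow> initial_vertex \<Gamma> (s x) = initial_vertex \<Gamma> (rev_dart \<Gamma> x)"
    using suc by metis
  define w where "w n = (s ^^ n) x" for n
  define V where "V n = initial_vertex \<Gamma> (w n)" for n
  have w: "w n \<in> Q" for n
    unfolding w_def by (induction n) (simp_all add: Q s)
  have V_Suc: "initial_vertex \<Gamma> (rev_dart \<Gamma> (w n)) = V (Suc n)" for n
    using s(2)[OF w[of n]] by (simp add: V_def w_def)
  have "range V \<subseteq> initial_vertex \<Gamma> ` darts \<Gamma>"
    using w Q by (auto simp: V_def)
  then have "finite (range V)"
    using finite_darts finite_subset by blast
  then have "\<not> inj V"
    using finite_imageD infinite_UNIV_nat by blast
  then have ex: "\<exists>j. \<exists>i<j. V i = V j"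
    unfolding inj_on_def by (metis linorder_neqE_nat)
  \<comment> \<open>The first time at which a vertex recurs; minimality makes the vertices at the
    times from \<open>i\<close> to \<open>j - 1\<close> pairwise distinct.\<close>
  define j where "j = (LEAST j. \<exists>i<j. V i = V j)"
  obtain i where i: "i < j" "V i = V j"
    using LeastI_ex[OF ex] unfolding j_def by blast
  have inj: "inj_on V {i..<j}"
  proof (rule linorder_inj_onI)
    fix a b assume ab: "a < b" "a \<in> {i..<j}" "b \<in> {i..<j}"
    then show "V a \<noteq> V b"
      using not_less_Least[of b "\<lambda>j. \<exists>i<j. V i = V j"] unfolding j_def by auto
  qed auto
  let ?c = "map w [i..<j]"
  have next_vertex: "initial_vertex \<Gamma> (rev_dart \<Gamma> (?c ! k)) = initial_vertex \<Gamma> (?c ! (Suc k mod length ?c))"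
    if k: "k < length ?c" for k
  \<comment> \<open>At the last index the successor wraps around to 0, and \<open>V i = V j\<close>
    closes the walk there.\<close>
  proof (cases "Suc k = j - i")
    case True
    then have "Suc (i + k) = j" using i by simp
    then show ?thesis
      using k i V_Suc[of "i + k"] True by (simp add: V_def)
  next
    case False
    then show ?thesis
      using k V_Suc[of "i + k"] by (simp add: V_def)
  qed
  have "map (initial_vertex \<Gamma>) ?c = map V [i..<j]"
    by (simp add: V_def)
  moreover have "distinct (map V [i..<j])"
    using inj by (simp add: distinct_map)
  ultimately have "distinct (map (initial_vertex \<Gamma>) ?c)"
    by metis
  moreover have c: "set ?c \<subseteq> Q" using w by auto
  moreover have "\<forall>y\<in>set ?c. rev_dart \<Gamma> y \<notin> set ?c" using c rev by blast
  moreover have "?c \<noteq> []" using i by simp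
  ultimately have "oriented_cycle \<Gamma> ?c"
    unfolding oriented_cycle_def using Q next_vertex by blast
  with c show thesis using that by blast
qed

text \<open>Positive darts can always be continued: the reverse of a positive dart leaves the
  terminal vertex with a negative value, so the zero sum over that star forces a positive dart
  leaving the same vertex.\<close>

lemma (in dart_graph) integer_harmonic_flow_zero:
  fixes z :: "'a \<Rightarrow> int"
  assumes anti: "\<And>x. x \<in> darts \<Gamma> \<Longrightarrow> z (rev_dart \<Gamma> x) = - z x"
    and star: "\<And>x. x \<in> darts \<Gamma> \<Longrightarrow> (\<Sum>y\<in>initial_vertex \<Gamma> x. z y) = 0"
    and cyc: "\<And>c. oriented_cycle \<Gamma> c \<Longrightarrow> (\<Sum>y\<in>set c. z y) = 0"
    and x: "x \<in> darts \<Gamma>"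
  shows "z x = 0"
proof (rule ccontr)
  assume "z x \<noteq> 0"
  define Q where "Q = {y \<in> darts \<Gamma>. z y > 0}"
  have "x \<in> Q \<or> rev_dart \<Gamma> x \<in> Q"
    using \<open>z x \<noteq> 0\<close> x anti rev_dart_closed by (auto simp: Q_def)
  then obtain x' where x': "x' \<in> Q" by blast
  have "\<exists>y\<in>Q. initial_vertex \<Gamma> y = initial_vertex \<Gamma> (rev_dart \<Gamma> a)" if a: "a \<in> Q" for a
  proof -
    let ?r = "rev_dart \<Gamma> a"
    let ?v = "initial_vertex \<Gamma> ?r"
    have r: "?r \<in> darts \<Gamma>" "z ?r < 0"
      using a anti[of a] rev_dart_closed by (auto simp: Q_def)
    have v: "?v \<subseteq> darts \<Gamma>" by (intro vertices_subset initial_vertex_in_vertices r)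
    then have fin: "finite ?v" using finite_darts finite_subset by blast
    have "?r \<in> ?v"
      unfolding initial_vertex_def by (rule equiv_class_self[OF equiv_same_vertex r(1)])
    have "\<exists>y\<in>?v. z y > 0"
    proof (rule ccontr)
      assume "\<not> ?thesis"
      then have "(\<Sum>y\<in>?v. z y) < (\<Sum>y\<in>?v. 0)"
        using \<open>?r \<in> ?v\<close> r fin by (intro sum_strict_mono_ex1) force+
      then show False using star[OF r(1)] by simp
    qed
    then obtain y where y: "y \<in> ?v" "z y > 0" by blast
    then have "y \<in> darts \<Gamma>" "(?r, y) \<in> same_vertex \<Gamma>"
      using v by (auto simp: initial_vertex_def)
    then show ?thesis
      using y initial_vertex_eq[OF r(1), of y] by (auto simp: Q_def)
  qed
  moreover have "rev_dart \<Gamma> y \<notin> Q" if "y \<in> Q" for y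
    using that anti[of y] by (auto simp: Q_def)
  ultimately obtain c where c: "oriented_cycle \<Gamma> c" "set c \<subseteq> Q"
    using oriented_cycle_in_closed_set[of Q x'] x' unfolding Q_def by blast
  then have "c \<noteq> []" by (simp add: oriented_cycle_def)
  then have "(\<Sum>y\<in>set c. z y) > 0"
    using c by (intro sum_pos) (auto simp: Q_def)
  then show False using cyc[OF c(1)] by simp
qed

lemma (in dart_graph) finite_carrier_if_harmonic_flow:
  assumes A: "comm_group A" and \<nu>: "harmonic_flow \<Gamma> A \<nu>"
    and ns: "\<And>x. x \<in> darts \<Gamma> \<Longrightarrow> \<not> semiedge \<Gamma> x"
  shows "finite (carrier A)"
proof -
  interpret A: comm_group A by fact
  have fl: "flow \<Gamma> A \<nu>" using \<nu> by (simp add: harmonic_flow_def)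
  note cl = flow_closed[OF fl]
  let ?comb = "dart_combination \<Gamma> A \<nu>"
  \<comment> \<open>Collecting every set with trivial product lets one estimate serve stars, cycles
    and edges alike; as a part of the power set the collection is finite.\<close>
  define \<S> where "\<S> = {S. S \<subseteq> darts \<Gamma> \<and> finprod A \<nu> S = \<one>\<^bsub>A\<^esub>}"
  have "finite \<S>"
    by (rule finite_subset[of _ "Pow (darts \<Gamma>)"]) (use finite_darts in \<open>auto simp: \<S>_def\<close>)
  define N where "N c = (\<Sum>x\<in>darts \<Gamma>. (c x)\<^sup>2)" for c :: "'a \<Rightarrow> int"
  have N_nonneg: "N c \<ge> 0" for c unfolding N_def by (intro sum_nonneg) simp
  have "\<exists>c. ?comb c = a \<and> (\<forall>d. ?comb d = a \<longrightarrow> N c \<le> N d)" if a: "a \<in> carrier A" for a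
  proof -
    obtain c where c: "a = ?comb c"
      using ex_dart_combination[OF A fl a] by blast
    \<comment> \<open>Well-ordering is applied to \<open>nat (N c)\<close>; since \<open>N\<close>
      is nonnegative, minimality carries back to the integers.\<close>
    then obtain d where "?comb d = a" "\<forall>e. ?comb e = a \<longrightarrow> nat (N d) \<le> nat (N e)"
      using ex_has_least_nat[of "\<lambda>c. ?comb c = a" c "\<lambda>c. nat (N c)"] by metis
    then show ?thesis using N_nonneg nat_le_eq_zle by (metis nat_le_iff)
  qed
  then obtain rep where rep: "\<And>a. a \<in> carrier A \<Longrightarrow> ?comb (rep a) = a"
      and min: "\<And>a d. a \<in> carrier A \<Longrightarrow> ?comb d = a \<Longrightarrow> N (rep a) \<le> N d"
    by metis
  define \<Phi> where "\<Phi> c = (\<lambda>S\<in>\<S>. \<Sum>x\<in>S. c x)" for c :: "'a \<Rightarrow> int"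
  let ?n = "int (card (darts \<Gamma>))"
  \<comment> \<open>Write s for the sum of \<open>rep a\<close> over \<open>S\<close>. Adding or
    subtracting the indicator of \<open>S\<close> changes the squared norm by \<open>card S\<close>
    plus or minus 2s, which minimality keeps nonnegative. So the absolute value of s is at most half
    of \<open>card S\<close>; \<open>?n\<close> is a cruder bound independent of
    \<open>S\<close>.\<close>
  have bound: "(\<Sum>x\<in>S. rep a x) \<in> {- ?n..?n}" if a: "a \<in> carrier A" and S: "S \<in> \<S>" for a S
  proof -
    let ?c = "rep a" and ?i = "\<lambda>x. of_bool (x \<in> S) :: int"
    have S': "S \<subseteq> darts \<Gamma>" "?comb ?i = \<one>\<^bsub>A\<^esub>"
      using S dart_combination_of_bool[OF A cl, where S = S] by (auto simp: \<S>_def)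
    have "?comb (\<lambda>x. ?c x + ?i x) = a"
      using dart_combination_add[OF A cl, where c = ?c and d = ?i] rep[OF a] S' a by simp
    moreover have "?comb (\<lambda>x. ?c x + - ?i x) = a"
      using dart_combination_add[OF A cl, where c = ?c and d = "\<lambda>x. - ?i x"]
        dart_combination_uminus[OF A cl, where c = ?i] rep[OF a] S' a
      by simp
    ultimately have le: "N ?c \<le> N (\<lambda>x. ?c x + ?i x)" "N ?c \<le> N (\<lambda>x. ?c x + - ?i x)"
      using min[OF a] by blast+
    \<comment> \<open>The parameter \<open>t\<close> treats addition and subtraction at once; only
      the values 1 and -1 are used.\<close>
    have exp: "N (\<lambda>x. ?c x + t * ?i x) = N ?c + 2 * t * (\<Sum>x\<in>S. ?c x) + t\<^sup>2 * int (card S)" for t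
    proof -
      have "N (\<lambda>x. ?c x + t * ?i x) =
          (\<Sum>x\<in>darts \<Gamma>. (?c x)\<^sup>2 + (if x \<in> S then 2 * t * ?c x + t\<^sup>2 else 0))"
        unfolding N_def by (intro sum.cong) (auto simp: power2_eq_square algebra_simps)
      also have "\<dots> = N ?c + (\<Sum>x\<in>S. 2 * t * ?c x + t\<^sup>2)"
        unfolding N_def sum.distrib
        using S' finite_darts by (simp add: Int_absorb1 sum.distrib flip: sum.inter_restrict)
      finally show ?thesis by (simp add: sum.distrib sum_distrib_left)
    qed
    have "card S \<le> card (darts \<Gamma>)" using S' finite_darts card_mono by blast
    then show ?thesis
      using le exp[of 1] exp[of "-1"] by simp
  qed
  have "(\<Phi> \<circ> rep) ` carrier A \<subseteq> \<S> \<rightarrow>\<^sub>E {- ?n..?n}"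
    using bound by (auto simp: \<Phi>_def)
  then have "finite ((\<Phi> \<circ> rep) ` carrier A)"
    by (rule finite_subset) (intro finite_PiE \<open>finite \<S>\<close> finite_atLeastAtMost_int)
  moreover have "inj_on (\<Phi> \<circ> rep) (carrier A)"
  proof (rule inj_onI)
    fix a b assume a: "a \<in> carrier A" and b: "b \<in> carrier A" and eq: "(\<Phi> \<circ> rep) a = (\<Phi> \<circ> rep) b"
    \<comment> \<open>Equal sums over all members of \<open>\<S>\<close> make this difference an
      integer harmonic flow: edges give antisymmetry, stars and cycles the two vanishing
      conditions.\<close>
    define z where "z x = rep a x - rep b x" for x
    have z: "(\<Sum>x\<in>S. z x) = 0" if "S \<in> \<S>" for S
      using fun_cong[OF eq, of S] that by (simp add: z_def \<Phi>_def sum_subtractf)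
    have "z x = 0" if "x \<in> darts \<Gamma>" for x
    proof (rule integer_harmonic_flow_zero[of z])
      fix y assume y: "y \<in> darts \<Gamma>"
      \<comment> \<open>Without semiedges the pair has two elements, so its sum is
        \<open>z y + z (rev_dart \<Gamma> y)\<close>.\<close>
      have ne: "y \<noteq> rev_dart \<Gamma> y" using ns[OF y] by (simp add: semiedge_def)
      have "finprod A \<nu> {y, rev_dart \<Gamma> y} = \<nu> y \<otimes>\<^bsub>A\<^esub> inv\<^bsub>A\<^esub> \<nu> y"
        using ne y cl[OF y] fl by (simp add: flow_def)
      then have "{y, rev_dart \<Gamma> y} \<in> \<S>"
        using y rev_dart_closed[OF y] cl[OF y] by (simp add: \<S>_def)
      then show "z (rev_dart \<Gamma> y) = - z y"
        using z[of "{y, rev_dart \<Gamma> y}"] ne by simp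
      have "initial_vertex \<Gamma> y \<in> \<S>"
        using y \<nu> vertices_subset[OF initial_vertex_in_vertices[OF y]]
        by (simp add: \<S>_def harmonic_flow_def)
      then show "(\<Sum>x\<in>initial_vertex \<Gamma> y. z x) = 0" by (rule z)
    next
      fix c assume "oriented_cycle \<Gamma> c"
      then have "set c \<in> \<S>"
        using \<nu> by (auto simp: \<S>_def harmonic_flow_def oriented_cycle_def)
      then show "(\<Sum>x\<in>set c. z x) = 0" by (rule z)
    qed fact
    then have "?comb (rep a) = ?comb (rep b)"
      by (intro dart_combination_cong[OF A cl]) (auto simp: z_def)
    then show "a = b" using rep a b by simp
  qed
  ultimately show ?thesis by (rule finite_imageD)
qed

section \<open>Automorphisms and harmonic flows\<close>

context dart_graph
begin

lemma finite_same_vertex: "finite (same_vertex \<Gamma>)"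
  using equiv_type[OF equiv_same_vertex] finite_darts finite_subset by blast

lemma graph_auto_bij: "f \<in> graph_auto \<Gamma> \<Longrightarrow> bij_betw f (darts \<Gamma>) (darts \<Gamma>)"
  by (simp add: graph_auto_def Bij_def)

lemma graph_auto_in_darts: "f \<in> graph_auto \<Gamma> \<Longrightarrow> x \<in> darts \<Gamma> \<Longrightarrow> f x \<in> darts \<Gamma>"
  using graph_auto_bij bij_betwE by blast

lemma graph_auto_rev_dart:
  "f \<in> graph_auto \<Gamma> \<Longrightarrow> x \<in> darts \<Gamma> \<Longrightarrow> f (rev_dart \<Gamma> x) = rev_dart \<Gamma> (f x)"
  by (simp add: graph_auto_def)

text \<open>The definition of an automorphism demands one direction only. The converse is a counting
  fact: \<open>f\<close> maps the finite relation injectively into itself, hence onto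
  itself.\<close>

lemma graph_auto_same_vertex_iff:
  assumes f: "f \<in> graph_auto \<Gamma>" and x: "x \<in> darts \<Gamma>" and y: "y \<in> darts \<Gamma>"
  shows "(f x, f y) \<in> same_vertex \<Gamma> \<longleftrightarrow> (x, y) \<in> same_vertex \<Gamma>"
proof
  let ?R = "same_vertex \<Gamma>"
  note inj = bij_betw_imp_inj_on[OF graph_auto_bij[OF f]]
  have sub: "?R \<subseteq> darts \<Gamma> \<times> darts \<Gamma>" by (rule equiv_type[OF equiv_same_vertex])
  have "inj_on (map_prod f f) ?R"
    by (rule inj_on_subset[OF map_prod_inj_on[OF inj inj] sub])
  moreover have "map_prod f f ` ?R \<subseteq> ?R"
    using f sub by (auto simp: graph_auto_def)
  ultimately have "map_prod f f ` ?R = ?R"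
    by (intro endo_inj_surj finite_same_vertex)
  moreover assume "(f x, f y) \<in> ?R"
  ultimately have "(f x, f y) \<in> map_prod f f ` ?R" by simp
  then obtain a b where ab: "(a, b) \<in> ?R" "f a = f x" "f b = f y"
    by auto
  then have "a = x" "b = y"
    using sub x y inj by (auto dest: inj_onD)
  with ab show "(x, y) \<in> ?R" by simp
qed (use assms in \<open>simp add: graph_auto_def\<close>)

lemma graph_auto_initial_vertex:
  assumes f: "f \<in> graph_auto \<Gamma>" and x: "x \<in> darts \<Gamma>"
  shows "initial_vertex \<Gamma> (f x) = f ` initial_vertex \<Gamma> x"
proof
  have sub: "initial_vertex \<Gamma> z \<subseteq> darts \<Gamma>" if "z \<in> darts \<Gamma>" for z
    using that by (intro vertices_subset initial_vertex_in_vertices)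
  show "initial_vertex \<Gamma> (f x) \<subseteq> f ` initial_vertex \<Gamma> x"
  proof
    fix y assume y: "y \<in> initial_vertex \<Gamma> (f x)"
    then have "y \<in> f ` darts \<Gamma>"
      using sub[OF graph_auto_in_darts[OF f x]] bij_betw_imp_surj_on[OF graph_auto_bij[OF f]] by blast
    then obtain z where "z \<in> darts \<Gamma>" "y = f z" by blast
    then show "y \<in> f ` initial_vertex \<Gamma> x"
      using y graph_auto_same_vertex_iff[OF f x, of z] by (auto simp: initial_vertex_def)
  qed
  show "f ` initial_vertex \<Gamma> x \<subseteq> initial_vertex \<Gamma> (f x)"
    using graph_auto_same_vertex_iff[OF f x] sub[OF x] by (auto simp: initial_vertex_def)
qed

section \<open>The automorphisms as a group\<close>

lemma subgroup_graph_auto: "subgroup (graph_auto \<Gamma>) (BijGroup (darts \<Gamma>))"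
proof -
  interpret B: group "BijGroup (darts \<Gamma>)" by (rule group_BijGroup)
  show ?thesis
  proof
    show "graph_auto \<Gamma> \<subseteq> carrier (BijGroup (darts \<Gamma>))"
      by (auto simp: graph_auto_def BijGroup_def)
    show "\<one>\<^bsub>BijGroup (darts \<Gamma>)\<^esub> \<in> graph_auto \<Gamma>"
      using id_Bij[of "darts \<Gamma>"] rev_dart_closed by (auto simp: graph_auto_def BijGroup_def)
  next
    fix f g assume f: "f \<in> graph_auto \<Gamma>" and g: "g \<in> graph_auto \<Gamma>"
    then have "f \<in> Bij (darts \<Gamma>)" "g \<in> Bij (darts \<Gamma>)" by (simp_all add: graph_auto_def)
    then show "f \<otimes>\<^bsub>BijGroup (darts \<Gamma>)\<^esub> g \<in> graph_auto \<Gamma>"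
      using graph_auto_in_darts[OF g] rev_dart_closed graph_auto_rev_dart[OF f]
        graph_auto_rev_dart[OF g] graph_auto_same_vertex_iff[OF f] graph_auto_same_vertex_iff[OF g]
      by (auto simp: graph_auto_def[of \<Gamma>] BijGroup_def compose_Bij compose_eq)
  next
    fix f assume f: "f \<in> graph_auto \<Gamma>"
    then have fB: "f \<in> Bij (darts \<Gamma>)" by (simp add: graph_auto_def)
    let ?g = "\<lambda>x\<in>darts \<Gamma>. inv_into (darts \<Gamma>) f x"
    have g: "?g x \<in> darts \<Gamma>" "f (?g x) = x" if "x \<in> darts \<Gamma>" for x
      using that graph_auto_bij[OF f] Bij_inv_into_mem[OF fB] bij_betw_inv_into_right by fastforce+
    have eq: "?g y = x" if "x \<in> darts \<Gamma>" "f x = y" for x y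
      using that graph_auto_bij[OF f] g by (metis bij_betw_inv_into_left graph_auto_in_darts[OF f] restrict_apply')
    have "?g (rev_dart \<Gamma> x) = rev_dart \<Gamma> (?g x)" if x: "x \<in> darts \<Gamma>" for x
      by (rule eq) (use g[OF x] graph_auto_rev_dart[OF f] rev_dart_closed in auto)
    \<comment> \<open>Closure under inverses needs vertex classes to be reflected by
      \<open>f\<close>, not merely preserved.\<close>
    moreover have "(?g x, ?g y) \<in> same_vertex \<Gamma>"
      if "x \<in> darts \<Gamma>" "y \<in> darts \<Gamma>" "(x, y) \<in> same_vertex \<Gamma>" for x y
      using graph_auto_same_vertex_iff[OF f, of "?g x" "?g y"] g that by metis
    ultimately have "?g \<in> graph_auto \<Gamma>"
      unfolding graph_auto_def using restrict_inv_into_Bij[OF fB] by blast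
    then show "inv\<^bsub>BijGroup (darts \<Gamma>)\<^esub> f \<in> graph_auto \<Gamma>"
      by (simp add: inv_BijGroup[OF fB])
  qed
qed

lemma group_GraphAutoGroup: "group (GraphAutoGroup \<Gamma>)"
  unfolding GraphAutoGroup_def
  by (rule subgroup.subgroup_is_group[OF subgroup_graph_auto group_BijGroup])

lemma graph_auto_mult:
  assumes "f \<in> graph_auto \<Gamma>" "g \<in> graph_auto \<Gamma>"
  shows "f \<otimes>\<^bsub>GraphAutoGroup \<Gamma>\<^esub> g = compose (darts \<Gamma>) f g"
  using assms by (simp add: GraphAutoGroup_def BijGroup_def graph_auto_def)

lemma graph_auto_oriented_cycle:
  assumes f: "f \<in> graph_auto \<Gamma>" and c: "oriented_cycle \<Gamma> c"
  shows "oriented_cycle \<Gamma> (map f c)"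
proof -
  note inj = bij_betw_imp_inj_on[OF graph_auto_bij[OF f]]
  have sub: "set c \<subseteq> darts \<Gamma>" and "c \<noteq> []" using c by (simp_all add: oriented_cycle_def)
  have c_in: "c ! i \<in> darts \<Gamma>" if "i < length c" for i
    using that sub by auto
  have "initial_vertex \<Gamma> (rev_dart \<Gamma> (map f c ! i)) = initial_vertex \<Gamma> (map f c ! (Suc i mod length (map f c)))"
    if i: "i < length c" for i
  proof -
    have j: "Suc i mod length c < length c" using i by (intro mod_less_divisor) linarith
    have "initial_vertex \<Gamma> (rev_dart \<Gamma> (f (c ! i))) = f ` initial_vertex \<Gamma> (rev_dart \<Gamma> (c ! i))"
      using f c_in[OF i] rev_dart_closed graph_auto_initial_vertex graph_auto_rev_dart by metis
    also have "\<dots> = f ` initial_vertex \<Gamma> (c ! (Suc i mod length c))"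
      using c i by (simp add: oriented_cycle_def)
    also have "\<dots> = initial_vertex \<Gamma> (f (c ! (Suc i mod length c)))"
      using graph_auto_initial_vertex[OF f c_in[OF j]] by simp
    finally show ?thesis using i j by simp
  qed
  moreover have "distinct (map (initial_vertex \<Gamma>) (map f c))"
  proof -
    have "inj_on (initial_vertex \<Gamma> \<circ> f) (set c)"
    proof (rule inj_onI)
      fix x y assume xy: "x \<in> set c" "y \<in> set c"
        and "(initial_vertex \<Gamma> \<circ> f) x = (initial_vertex \<Gamma> \<circ> f) y"
      then have "(f x, f y) \<in> same_vertex \<Gamma>"
        using initial_vertex_eq graph_auto_in_darts[OF f] sub by (auto simp: subset_iff)
      then have "initial_vertex \<Gamma> x = initial_vertex \<Gamma> y"
        using xy sub initial_vertex_eq graph_auto_same_vertex_iff[OF f] by (auto simp: subset_iff)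
      then show "x = y"
        using c xy by (auto simp: oriented_cycle_def distinct_map dest: inj_onD)
    qed
    then show ?thesis
      using c by (simp add: oriented_cycle_def distinct_map)
  qed
  moreover have "\<forall>x\<in>set (map f c). rev_dart \<Gamma> x \<notin> set (map f c)"
  proof clarsimp
    fix x y assume xy: "x \<in> set c" "y \<in> set c" "rev_dart \<Gamma> (f x) = f y"
    then have "f (rev_dart \<Gamma> x) = f y" using sub graph_auto_rev_dart[OF f] by auto
    then have "rev_dart \<Gamma> x = y"
      using xy sub inj rev_dart_closed by (metis inj_onD subsetD)
    then show False using c xy by (auto simp: oriented_cycle_def)
  qed
  ultimately show ?thesis
    using \<open>c \<noteq> []\<close> sub graph_auto_in_darts[OF f] unfolding oriented_cycle_def by auto
qed

text \<open>An automorphism permutes the stars and maps oriented cycles to oriented cycles, so both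
  kinds of sums are reindexed into sums of the same kind; surjectivity on darts keeps the set of
  values, hence the generated group.\<close>

lemma harmonic_flow_graph_auto:
  assumes A: "comm_group A" and \<nu>: "harmonic_flow \<Gamma> A \<nu>" and f: "f \<in> graph_auto \<Gamma>"
  shows "harmonic_flow \<Gamma> A (\<nu> \<circ> f)"
proof -
  interpret A: comm_group A by fact
  have fl: "flow \<Gamma> A \<nu>" using \<nu> by (simp add: harmonic_flow_def)
  note cl = flow_closed[OF fl]
  note surj = bij_betw_imp_surj_on[OF graph_auto_bij[OF f]]
  have prod: "finprod A (\<nu> \<circ> f) S = finprod A \<nu> (f ` S)" if "S \<subseteq> darts \<Gamma>" for S
    using that cl graph_auto_in_darts[OF f]
      inj_on_subset[OF bij_betw_imp_inj_on[OF graph_auto_bij[OF f]] that]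
    by (subst A.finprod_reindex) (auto simp: comp_def)
  have "flow \<Gamma> A (\<nu> \<circ> f)"
    using fl f cl graph_auto_in_darts[OF f] unfolding flow_def image_comp[symmetric] surj
    by (auto simp: graph_auto_rev_dart)
  moreover have "finprod A (\<nu> \<circ> f) (initial_vertex \<Gamma> x) = \<one>\<^bsub>A\<^esub>" if x: "x \<in> darts \<Gamma>" for x
    using prod[OF vertices_subset[OF initial_vertex_in_vertices[OF x]],
        folded graph_auto_initial_vertex[OF f x]] \<nu> graph_auto_in_darts[OF f x]
    by (simp add: harmonic_flow_def)
  moreover have "finprod A (\<nu> \<circ> f) (set c) = \<one>\<^bsub>A\<^esub>" if c: "oriented_cycle \<Gamma> c" for c
    using prod[of "set c"] \<nu> graph_auto_oriented_cycle[OF f c] c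
    by (simp add: harmonic_flow_def oriented_cycle_def flip: set_map)
  ultimately show ?thesis by (simp add: harmonic_flow_def)
qed

end

section \<open>The homomorphism \<open>\<Theta>\<close>\<close>

locale jacobian_flow = dart_graph +
  fixes P :: "'a set" and \<xi> :: "'a \<Rightarrow> ('a \<Rightarrow>\<^sub>0 int) set"
  assumes orient: "orientation \<Gamma> P"
    and no_semiedge: "\<And>x. x \<in> darts \<Gamma> \<Longrightarrow> \<not> semiedge \<Gamma> x"
    and harm: "harmonic_flow \<Gamma> (Jac \<Gamma> P) \<xi>"
begin

lemma comm_group_Jac': "comm_group (Jac \<Gamma> P)"
  by (rule comm_group_Jac[OF orient])

sublocale J: comm_group "Jac \<Gamma> P"
  by (rule comm_group_Jac')

lemma flow_xi: "flow \<Gamma> (Jac \<Gamma> P) \<xi>"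
  using harm by (simp add: harmonic_flow_def)

lemmas xi_closed = flow_closed[OF flow_xi]

text \<open>A surjective endomorphism of a finite group is injective.\<close>

lemma harmonic_flow_factors_iso:
  assumes \<nu>: "harmonic_flow \<Gamma> (Jac \<Gamma> P) \<nu>"
  obtains h where "h \<in> iso (Jac \<Gamma> P) (Jac \<Gamma> P)"
    "\<And>x. x \<in> darts \<Gamma> \<Longrightarrow> h (canonical_flow \<Gamma> P x) = \<nu> x"
proof -
  obtain h where h: "h \<in> epi (Jac \<Gamma> P) (Jac \<Gamma> P)"
    and hx: "\<And>x. x \<in> darts \<Gamma> \<Longrightarrow> h (canonical_flow \<Gamma> P x) = \<nu> x"
    using harmonic_flow_factors[OF comm_group_Jac' orient \<nu>] by blast
  have "finite (carrier (Jac \<Gamma> P))"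
    by (rule finite_carrier_if_harmonic_flow[OF comm_group_Jac' harm no_semiedge])
  then have "inj_on h (carrier (Jac \<Gamma> P))"
    using h by (intro eq_card_imp_inj_on) (auto simp: epi_def)
  then have "h \<in> iso (Jac \<Gamma> P) (Jac \<Gamma> P)"
    using h by (simp add: iso_iff_mon_epi mon_def epi_def)
  then show thesis using that hx by blast
qed

text \<open>Both \<open>\<xi>\<close> and \<open>\<nu>\<close> arise from the canonical flow by
  isomorphisms \<open>g\<close> and \<open>k\<close>, so \<open>k\<close> after the inverse of
  \<open>g\<close> carries one to the other.\<close>

lemma ex_auto_to_harmonic_flow:
  assumes \<nu>: "harmonic_flow \<Gamma> (Jac \<Gamma> P) \<nu>"
  obtains h where "h \<in> auto (Jac \<Gamma> P)" "\<And>x. x \<in> darts \<Gamma> \<Longrightarrow> h (\<xi> x) = \<nu> x"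
proof -
  let ?C = "carrier (Jac \<Gamma> P)"
  obtain g where g: "g \<in> iso (Jac \<Gamma> P) (Jac \<Gamma> P)"
    and gx: "\<And>x. x \<in> darts \<Gamma> \<Longrightarrow> g (canonical_flow \<Gamma> P x) = \<xi> x"
    using harmonic_flow_factors_iso[OF harm] by blast
  obtain k where k: "k \<in> iso (Jac \<Gamma> P) (Jac \<Gamma> P)"
    and kx: "\<And>x. x \<in> darts \<Gamma> \<Longrightarrow> k (canonical_flow \<Gamma> P x) = \<nu> x"
    using harmonic_flow_factors_iso[OF \<nu>] by blast
  \<comment> \<open>Members of \<open>auto\<close> are extensional, hence the restriction to the
    carrier.\<close>
  define h where "h = restrict (k \<circ> inv_into ?C g) ?C"
  have "k \<circ> inv_into ?C g \<in> iso (Jac \<Gamma> P) (Jac \<Gamma> P)"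
    using J.iso_set_sym[OF g] k by (rule iso_set_trans)
  then have "h \<in> auto (Jac \<Gamma> P)"
    by (auto simp: h_def auto_def iso_def Bij_def hom_def Pi_iff bij_betw_restrict_eq)
  moreover have "h (\<xi> x) = \<nu> x" if x: "x \<in> darts \<Gamma>" for x
  proof -
    have can: "canonical_flow \<Gamma> P x \<in> ?C"
      using harmonic_canonical_flow[OF orient no_semiedge] x
      by (auto simp: harmonic_flow_def intro: flow_closed)
    have "inj_on g ?C" using g by (simp add: iso_def bij_betw_def)
    then have "inv_into ?C g (\<xi> x) = canonical_flow \<Gamma> P x"
      using can gx[OF x] inv_into_f_f by metis
    then show ?thesis using kx[OF x] xi_closed[OF x] by (simp add: h_def)
  qed
  ultimately show thesis using that by blast
qed

lemma auto_Jac_dart_combination: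
  assumes "h \<in> auto (Jac \<Gamma> P)" "f \<in> graph_auto \<Gamma>" "\<And>x. x \<in> darts \<Gamma> \<Longrightarrow> h (\<xi> x) = \<xi> (f x)"
  shows "h (dart_combination \<Gamma> (Jac \<Gamma> P) \<xi> c) = dart_combination \<Gamma> (Jac \<Gamma> P) (\<xi> \<circ> f) c"
proof -
  have hom: "h \<in> hom (Jac \<Gamma> P) (Jac \<Gamma> P)" using assms(1) by (simp add: auto_def)
  have "h (dart_combination \<Gamma> (Jac \<Gamma> P) \<xi> c) = dart_combination \<Gamma> (Jac \<Gamma> P) (h \<circ> \<xi>) c"
    by (rule dart_combination_hom[OF comm_group_Jac' comm_group_Jac' hom xi_closed])
  also have "\<dots> = dart_combination \<Gamma> (Jac \<Gamma> P) (\<xi> \<circ> f) c"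
    using assms(3) xi_closed graph_auto_in_darts[OF assms(2)]
    by (intro dart_combination_cong comm_group_Jac') auto
  finally show ?thesis .
qed

text \<open>This reduces every computation of \<open>Theta\<close> to values on darts; both the
  existence of the induced automorphism and multiplicativity are derived through it.\<close>

lemma Theta_eqI:
  assumes h: "h \<in> auto (Jac \<Gamma> P)" and f: "f \<in> graph_auto \<Gamma>"
    and hx: "\<And>x. x \<in> darts \<Gamma> \<Longrightarrow> h (\<xi> x) = \<xi> (f x)"
  shows "Theta \<Gamma> (Jac \<Gamma> P) \<xi> f = h"
  unfolding Theta_def
proof (rule the_equality)
  show "h \<in> auto (Jac \<Gamma> P) \<and> (\<forall>c. h (dart_combination \<Gamma> (Jac \<Gamma> P) \<xi> c) =
      dart_combination \<Gamma> (Jac \<Gamma> P) (\<xi> \<circ> f) c)"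
    using h auto_Jac_dart_combination[OF h f hx] by blast
next
  fix k assume k: "k \<in> auto (Jac \<Gamma> P) \<and> (\<forall>c. k (dart_combination \<Gamma> (Jac \<Gamma> P) \<xi> c) =
      dart_combination \<Gamma> (Jac \<Gamma> P) (\<xi> \<circ> f) c)"
  show "k = h"
  proof (rule extensionalityI)
    show "k \<in> extensional (carrier (Jac \<Gamma> P))" "h \<in> extensional (carrier (Jac \<Gamma> P))"
      using k h by (simp_all add: auto_def Bij_def)
    fix a assume "a \<in> carrier (Jac \<Gamma> P)"
    then obtain c where "a = dart_combination \<Gamma> (Jac \<Gamma> P) \<xi> c"
      using ex_dart_combination[OF comm_group_Jac' flow_xi] by blast
    then show "k a = h a"
      using k auto_Jac_dart_combination[OF h f hx] by simp
  qed
qed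

text \<open>The flow \<open>\<xi> \<circ> f\<close> is again harmonic, so some automorphism of the
  Jacobian carries \<open>\<xi>\<close> to it, and this is the one that \<open>Theta\<close>
  selects.\<close>

lemma Theta_auto:
  assumes f: "f \<in> graph_auto \<Gamma>"
  shows "Theta \<Gamma> (Jac \<Gamma> P) \<xi> f \<in> auto (Jac \<Gamma> P)"
    and "x \<in> darts \<Gamma> \<Longrightarrow> Theta \<Gamma> (Jac \<Gamma> P) \<xi> f (\<xi> x) = \<xi> (f x)"
proof -
  obtain h where h: "h \<in> auto (Jac \<Gamma> P)" "\<And>x. x \<in> darts \<Gamma> \<Longrightarrow> h (\<xi> x) = (\<xi> \<circ> f) x"
    using ex_auto_to_harmonic_flow[OF harmonic_flow_graph_auto[OF comm_group_Jac' harm f]] by blast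
  then have "Theta \<Gamma> (Jac \<Gamma> P) \<xi> f = h"
    using f by (intro Theta_eqI) auto
  with h show "Theta \<Gamma> (Jac \<Gamma> P) \<xi> f \<in> auto (Jac \<Gamma> P)"
    "x \<in> darts \<Gamma> \<Longrightarrow> Theta \<Gamma> (Jac \<Gamma> P) \<xi> f (\<xi> x) = \<xi> (f x)"
    by simp_all
qed

lemma Theta_hom: "Theta \<Gamma> (Jac \<Gamma> P) \<xi> \<in> hom (GraphAutoGroup \<Gamma>) (AutoGroup (Jac \<Gamma> P))"
proof (rule homI)
  fix f assume "f \<in> carrier (GraphAutoGroup \<Gamma>)"
  then show "Theta \<Gamma> (Jac \<Gamma> P) \<xi> f \<in> carrier (AutoGroup (Jac \<Gamma> P))"
    by (simp add: GraphAutoGroup_def AutoGroup_def Theta_auto)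
next
  let ?T = "Theta \<Gamma> (Jac \<Gamma> P) \<xi>"
  interpret Au: group "AutoGroup (Jac \<Gamma> P)" by (rule J.AutoGroup)
  interpret Gr: group "GraphAutoGroup \<Gamma>" by (rule group_GraphAutoGroup)
  fix f g assume "f \<in> carrier (GraphAutoGroup \<Gamma>)" "g \<in> carrier (GraphAutoGroup \<Gamma>)"
  then have f: "f \<in> graph_auto \<Gamma>" and g: "g \<in> graph_auto \<Gamma>"
    and fg: "f \<otimes>\<^bsub>GraphAutoGroup \<Gamma>\<^esub> g \<in> graph_auto \<Gamma>"
    using Gr.m_closed[of f g] by (simp_all add: GraphAutoGroup_def)
  have m: "?T f \<otimes>\<^bsub>AutoGroup (Jac \<Gamma> P)\<^esub> ?T g = compose (carrier (Jac \<Gamma> P)) (?T f) (?T g)"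
    using Theta_auto(1)[OF f] Theta_auto(1)[OF g] by (simp add: AutoGroup_def BijGroup_def auto_def)
  show "?T (f \<otimes>\<^bsub>GraphAutoGroup \<Gamma>\<^esub> g) = ?T f \<otimes>\<^bsub>AutoGroup (Jac \<Gamma> P)\<^esub> ?T g"
  proof (rule Theta_eqI[OF _ fg])
    show "?T f \<otimes>\<^bsub>AutoGroup (Jac \<Gamma> P)\<^esub> ?T g \<in> auto (Jac \<Gamma> P)"
      using Au.m_closed[of "?T f" "?T g"] Theta_auto(1)[OF f] Theta_auto(1)[OF g]
      by (simp add: AutoGroup_def)
    fix x assume x: "x \<in> darts \<Gamma>"
    then show "(?T f \<otimes>\<^bsub>AutoGroup (Jac \<Gamma> P)\<^esub> ?T g) (\<xi> x) = \<xi> ((f \<otimes>\<^bsub>GraphAutoGroup \<Gamma>\<^esub> g) x)"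
      unfolding m graph_auto_mult[OF f g]
      using xi_closed graph_auto_in_darts[OF g x] Theta_auto(2)[OF f] Theta_auto(2)[OF g x]
      by (simp add: compose_eq)
  qed
qed

lemma Theta_inj_on:
  assumes "inj_on \<xi> (darts \<Gamma>)"
  shows "inj_on (Theta \<Gamma> (Jac \<Gamma> P) \<xi>) (graph_auto \<Gamma>)"
proof (rule inj_onI)
  fix f g assume f: "f \<in> graph_auto \<Gamma>" and g: "g \<in> graph_auto \<Gamma>"
    and eq: "Theta \<Gamma> (Jac \<Gamma> P) \<xi> f = Theta \<Gamma> (Jac \<Gamma> P) \<xi> g"
  show "f = g"
  proof (rule extensionalityI)
    show "f \<in> extensional (darts \<Gamma>)" "g \<in> extensional (darts \<Gamma>)"
      using f g by (simp_all add: graph_auto_def Bij_def)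
    fix x assume x: "x \<in> darts \<Gamma>"
    then have "\<xi> (f x) = \<xi> (g x)"
      using Theta_auto(2)[OF f x] Theta_auto(2)[OF g x] eq by simp
    then show "f x = g x"
      using assms graph_auto_in_darts[OF f x] graph_auto_in_darts[OF g x] by (auto dest: inj_onD)
  qed
qed

end

section \<open>Boundaries of elements of the Jacobian subgroup\<close>

text \<open>The simplicial boundary operator from 1-chains to 0-chains, with sign initial minus
  terminal. Summing over \<open>P\<close> captures a whole chain because its support lies in
  \<open>P\<close>.\<close>

definition boundary :: "'a dart_graph \<Rightarrow> 'a set \<Rightarrow> ('a \<Rightarrow>\<^sub>0 int) \<Rightarrow> 'a set \<Rightarrow> int" where
  "boundary \<Gamma> P a v = (\<Sum>x\<in>P. Poly_Mapping.lookup a x *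
     (of_bool (initial_vertex \<Gamma> x = v) - of_bool (initial_vertex \<Gamma> (rev_dart \<Gamma> x) = v)))"

text \<open>The graph Laplacian: degree times the value at \<open>v\<close>, minus the values at the
  neighbours. Writing it over all darts with an indicator makes it suitable for
  \<open>sum.swap\<close> and gives 0 when \<open>v\<close> is not a vertex.\<close>

definition laplacian :: "'a dart_graph \<Rightarrow> ('a set \<Rightarrow> int) \<Rightarrow> 'a set \<Rightarrow> int" where
  "laplacian \<Gamma> \<phi> v = (\<Sum>y\<in>darts \<Gamma>. of_bool (initial_vertex \<Gamma> y = v) *
     (\<phi> (initial_vertex \<Gamma> y) - \<phi> (initial_vertex \<Gamma> (rev_dart \<Gamma> y))))"

lemma boundary_0 [simp]: "boundary \<Gamma> P 0 v = 0"
  by (simp add: boundary_def)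

lemma boundary_add: "boundary \<Gamma> P (a + b) v = boundary \<Gamma> P a v + boundary \<Gamma> P b v"
  by (simp add: boundary_def lookup_add algebra_simps sum.distrib sum_subtractf)

lemma boundary_uminus: "boundary \<Gamma> P (- a) v = - boundary \<Gamma> P a v"
  by (simp add: boundary_def algebra_simps flip: sum_negf)

lemma boundary_sum: "boundary \<Gamma> P (\<Sum>x\<in>S. f x) v = (\<Sum>x\<in>S. boundary \<Gamma> P (f x) v)"
  by (induction S rule: infinite_finite_induct) (simp_all add: boundary_add)

lemma laplacian_add: "laplacian \<Gamma> (\<lambda>u. \<phi> u + \<psi> u) v = laplacian \<Gamma> \<phi> v + laplacian \<Gamma> \<psi> v"
  by (simp add: laplacian_def algebra_simps sum.distrib sum_subtractf)

lemma laplacian_uminus: "laplacian \<Gamma> (\<lambda>u. - \<phi> u) v = - laplacian \<Gamma> \<phi> v"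
  by (simp add: laplacian_def algebra_simps flip: sum_negf)

section \<open>Boundaries of darts, cycles and stars\<close>

context dart_graph
begin

lemma vertex_eq_darts_at:
  assumes "v \<in> vertices \<Gamma>"
  shows "v = {y \<in> darts \<Gamma>. initial_vertex \<Gamma> y = v}"
proof -
  obtain x where x: "x \<in> darts \<Gamma>" "v = initial_vertex \<Gamma> x"
    using assms by (auto simp: vertices_def initial_vertex_def elim: quotientE)
  then show ?thesis
    using vertices_subset[OF assms] initial_vertex_eq[OF x(1)] by (auto simp: initial_vertex_def)
qed

lemma finite_vertices: "finite (vertices \<Gamma>)"
  unfolding vertices_def by (rule finite_quotient[OF finite_darts equiv_type[OF equiv_same_vertex]])

lemma boundary_dart_elem:
  assumes P: "orientation \<Gamma> P" and x: "x \<in> darts \<Gamma>"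
  shows "boundary \<Gamma> P (dart_elem \<Gamma> P x) v =
    of_bool (initial_vertex \<Gamma> x = v) - of_bool (initial_vertex \<Gamma> (rev_dart \<Gamma> x) = v)"
proof -
  have fin: "finite P"
    using P finite_darts finite_subset by (auto simp: orientation_def)
  have frag: "boundary \<Gamma> P (frag_of z) v =
      of_bool (initial_vertex \<Gamma> z = v) - of_bool (initial_vertex \<Gamma> (rev_dart \<Gamma> z) = v)"
    if z: "z \<in> P" for z
  proof -
    have "boundary \<Gamma> P (frag_of z) v = (\<Sum>x\<in>P. if x = z then
        of_bool (initial_vertex \<Gamma> x = v) - of_bool (initial_vertex \<Gamma> (rev_dart \<Gamma> x) = v) else 0)"
      unfolding boundary_def by (rule sum.cong) (simp_all add: lookup_frag_of)
    then show ?thesis using fin z by simp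
  qed
  show ?thesis
  proof (cases "x \<in> P")
    case False
    then have "rev_dart \<Gamma> x \<in> P"
      using P x by (force simp: orientation_def edges_def edge_of_def)
    then show ?thesis
      using False frag[of "rev_dart \<Gamma> x"] rev_rev_dart[OF x] by (simp add: dart_elem_def boundary_uminus)
  qed (simp add: dart_elem_def frag)
qed

text \<open>The list of terminal vertices of a cycle is its list of initial vertices rotated by one
  place, so the two contributions cancel.\<close>

lemma boundary_oriented_cycle:
  assumes P: "orientation \<Gamma> P" and c: "oriented_cycle \<Gamma> c"
  shows "boundary \<Gamma> P (\<Sum>x\<in>set c. dart_elem \<Gamma> P x) v = 0"
proof -
  let ?I = "initial_vertex \<Gamma>" and ?g = "\<lambda>u. of_bool (u = v) :: int"
  have sub: "set c \<subseteq> darts \<Gamma>" and dist: "distinct c"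
    using c by (auto simp: oriented_cycle_def distinct_map)
  have "map (?I \<circ> rev_dart \<Gamma>) c = rotate1 (map ?I c)"
    using c by (intro nth_equalityI) (auto simp: nth_rotate1 oriented_cycle_def)
  moreover have "sum_list (map ?g (rotate1 xs)) = sum_list (map ?g xs)" for xs
    by (cases xs) simp_all
  ultimately have "sum_list (map ?g (map (?I \<circ> rev_dart \<Gamma>) c)) = sum_list (map ?g (map ?I c))"
    by metis
  then have "(\<Sum>x\<in>set c. ?g (?I (rev_dart \<Gamma> x))) = (\<Sum>x\<in>set c. ?g (?I x))"
    unfolding map_map comp_def sum_list_distinct_conv_sum_set[OF dist] .
  moreover have "boundary \<Gamma> P (\<Sum>x\<in>set c. dart_elem \<Gamma> P x) v =
      (\<Sum>x\<in>set c. ?g (?I x) - ?g (?I (rev_dart \<Gamma> x)))"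
    unfolding boundary_sum using sub by (intro sum.cong refl boundary_dart_elem[OF P]) blast
  ultimately show ?thesis by (simp add: sum_subtractf)
qed

lemma boundary_star:
  assumes P: "orientation \<Gamma> P" and u: "u \<in> vertices \<Gamma>"
  shows "boundary \<Gamma> P (\<Sum>y\<in>u. dart_elem \<Gamma> P y) v = laplacian \<Gamma> (\<lambda>w. of_bool (w = u)) v"
proof -
  let ?I = "initial_vertex \<Gamma>" and ?r = "rev_dart \<Gamma>"
  have "boundary \<Gamma> P (\<Sum>y\<in>u. dart_elem \<Gamma> P y) v =
      (\<Sum>y\<in>{y \<in> darts \<Gamma>. ?I y = u}. of_bool (?I y = v) - of_bool (?I (?r y) = v))"
    unfolding boundary_sum
    by (intro sum.cong[OF vertex_eq_darts_at[OF u]] boundary_dart_elem[OF P]) blast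
  also have "\<dots> = (\<Sum>y\<in>darts \<Gamma>. of_bool (?I y = u) * (of_bool (?I y = v) - of_bool (?I (?r y) = v)))"
    using finite_darts by (intro sum.mono_neutral_cong_left) auto
  also have "\<dots> = (\<Sum>y\<in>darts \<Gamma>. of_bool (?I y = u) * of_bool (?I y = v)) -
      (\<Sum>y\<in>darts \<Gamma>. of_bool (?I y = u) * of_bool (?I (?r y) = v))"
    by (simp add: right_diff_distrib sum_subtractf)
  \<comment> \<open>Reversing all darts exchanges the two endpoints; this is the symmetry of the
    Laplacian.\<close>
  also have "(\<Sum>y\<in>darts \<Gamma>. of_bool (?I y = u) * of_bool (?I (?r y) = v)) =
      (\<Sum>y\<in>darts \<Gamma>. of_bool (?I (?r y) = u) * (of_bool (?I y = v) :: int))"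
    by (rule sum.reindex_bij_witness[of _ ?r ?r]) (simp_all add: rev_rev_dart rev_dart_closed)
  finally show ?thesis
    by (simp add: laplacian_def right_diff_distrib sum_subtractf mult.commute)
qed

text \<open>Boundaries of the Jacobian subgroup are principal divisors. The potential is 0 for a
  cycle and the indicator of the vertex for a star, and potentials add along with group
  elements.\<close>

lemma boundary_jac_subgroup:
  assumes P: "orientation \<Gamma> P" and a: "a \<in> jac_subgroup \<Gamma> P"
  shows "\<exists>\<phi>. \<forall>v. boundary \<Gamma> P a v = laplacian \<Gamma> \<phi> v"
proof -
  let ?B = "\<lambda>a. \<exists>\<phi>. \<forall>v. boundary \<Gamma> P a v = laplacian \<Gamma> \<phi> v"
  have relator: "?B a" if "a \<in> jac_relators \<Gamma> P" for a
    using that unfolding jac_relators_def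
  proof (elim UnE CollectE exE conjE)
    fix c assume "a = (\<Sum>x\<in>set c. dart_elem \<Gamma> P x)" "oriented_cycle \<Gamma> c"
    then have "\<forall>v. boundary \<Gamma> P a v = laplacian \<Gamma> (\<lambda>_. 0) v"
      by (simp add: boundary_oriented_cycle[OF P] laplacian_def)
    then show ?thesis by blast
  next
    fix u assume "a = (\<Sum>y\<in>u. dart_elem \<Gamma> P y)" "u \<in> vertices \<Gamma>"
    then show ?thesis using boundary_star[OF P] by blast
  qed
  show ?thesis
    using a unfolding jac_subgroup_def
  proof induction
    case one
    have "\<forall>v. boundary \<Gamma> P 0 v = laplacian \<Gamma> (\<lambda>_. 0) v" by (simp add: laplacian_def)
    then show ?case unfolding one_free_Abelian_group by blast
  next
    case (incl h)
    then show ?case by (rule relator)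
  next
    case (inv h)
    then obtain \<phi> where "\<forall>v. boundary \<Gamma> P h v = laplacian \<Gamma> \<phi> v" using relator by blast
    then have "\<forall>v. boundary \<Gamma> P (- h) v = laplacian \<Gamma> (\<lambda>u. - \<phi> u) v"
      by (simp add: boundary_uminus laplacian_uminus)
    moreover have "inv\<^bsub>free_Abelian_group P\<^esub> h = - h"
      using inv jac_relators_subset[OF P]
      by (intro inv_free_Abelian_group) (auto simp flip: carrier_free_Abelian_group_iff)
    ultimately show ?case by auto
  next
    case (eng h1 h2)
    then obtain \<phi> \<psi> where "\<forall>v. boundary \<Gamma> P h1 v = laplacian \<Gamma> \<phi> v"
        "\<forall>v. boundary \<Gamma> P h2 v = laplacian \<Gamma> \<psi> v"
      by blast
    then have "\<forall>v. boundary \<Gamma> P (h1 + h2) v = laplacian \<Gamma> (\<lambda>u. \<phi> u + \<psi> u) v"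
      by (simp add: boundary_add laplacian_add)
    then show ?case unfolding mult_free_Abelian_group by blast
  qed
qed

section \<open>Injectivity of harmonic flows on darts\<close>

text \<open>Deleting the edges that leave \<open>A\<close> confines every walk from \<open>a\<close>
  to \<open>A\<close>. If there were fewer than \<open>k\<close> of them, the graph would have to
  stay connected.\<close>

lemma edge_cut_ge:
  assumes ec: "edge_connected k \<Gamma>" and A: "A \<subseteq> vertices \<Gamma>" "a \<in> A" "u \<in> vertices \<Gamma>" "u \<notin> A"
  shows "k \<le> card {z \<in> darts \<Gamma>. initial_vertex \<Gamma> z \<in> A \<and> initial_vertex \<Gamma> (rev_dart \<Gamma> z) \<notin> A}"
    (is "k \<le> card ?C")
proof (rule ccontr)
  assume "\<not> ?thesis"
  moreover have "card (edge_of \<Gamma> ` ?C) \<le> card ?C"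
    using finite_darts by (intro card_image_le) simp
  moreover have "edge_of \<Gamma> ` ?C \<subseteq> edges \<Gamma>" by (auto simp: edges_def)
  ultimately have "connected_without \<Gamma> (edge_of \<Gamma> ` ?C)"
    using ec unfolding edge_connected_def by (metis (lifting) leI le_less_trans)
  then have "(a, u) \<in> (adjacent_without \<Gamma> (edge_of \<Gamma> ` ?C))\<^sup>*"
    using A unfolding connected_without_def by blast
  then have "u \<in> A"
  proof induction
    case (step v w)
    then show ?case by (auto simp: adjacent_without_def)
  qed (rule A)
  with A show False by simp
qed

text \<open>Maximum principle: a dart leaving \<open>A\<close> goes to a strictly smaller value, and
  for an integer function the drop is at least 1. Darts inside \<open>A\<close> contribute
  0.\<close>

lemma sum_laplacian_maxima_ge:
  assumes max: "\<And>v. v \<in> vertices \<Gamma> \<Longrightarrow> \<phi> v \<le> M"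
    and A: "A = {v \<in> vertices \<Gamma>. \<phi> v = M}"
  shows "int (card {z \<in> darts \<Gamma>. initial_vertex \<Gamma> z \<in> A \<and> initial_vertex \<Gamma> (rev_dart \<Gamma> z) \<notin> A})
    \<le> (\<Sum>v\<in>A. laplacian \<Gamma> \<phi> v)"
    (is "int (card ?C) \<le> _")
proof -
  let ?I = "initial_vertex \<Gamma>" and ?r = "rev_dart \<Gamma>"
  have fin: "finite A" using finite_vertices A by simp
  have "int (card ?C) = (\<Sum>z\<in>darts \<Gamma>. of_bool (z \<in> ?C))"
    using finite_darts by (simp add: of_bool_def flip: sum.inter_filter)
  also have "\<dots> \<le> (\<Sum>z\<in>darts \<Gamma>. of_bool (?I z \<in> A) * (\<phi> (?I z) - \<phi> (?I (?r z))))"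
  proof (rule sum_mono)
    fix z assume z: "z \<in> darts \<Gamma>"
    then have "?I (?r z) \<in> vertices \<Gamma>"
      by (intro initial_vertex_in_vertices rev_dart_closed)
    then show "of_bool (z \<in> ?C) \<le> of_bool (?I z \<in> A) * (\<phi> (?I z) - \<phi> (?I (?r z)))"
      using max[of "?I (?r z)"] z by (auto simp: A)
  qed
  \<comment> \<open>The indicator of \<open>A\<close> is split into indicators of its vertices, so
    that exchanging the sums produces Laplacians.\<close>
  also have "\<dots> = (\<Sum>z\<in>darts \<Gamma>. \<Sum>v\<in>A. of_bool (?I z = v) * (\<phi> (?I z) - \<phi> (?I (?r z))))"
    using fin by (intro sum.cong) (auto simp: of_bool_def if_distrib if_distribR cong: if_cong)
  also have "\<dots> = (\<Sum>v\<in>A. laplacian \<Gamma> \<phi> v)"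
    unfolding laplacian_def by (rule sum.swap)
  finally show ?thesis .
qed

text \<open>If two darts have equal images in the Jacobian, the difference of their boundaries is a
  Laplacian \<open>\<Delta> \<phi>\<close>. Summed over the set where \<open>\<phi>\<close> is maximal, the difference is at most \<open>2\<close>
  and \<open>\<Delta> \<phi>\<close> at least the number of edges leaving the set, so \<open>\<phi>\<close> is constant.\<close>

lemma inj_on_canonical_flow:
  assumes simp: "simple_graph \<Gamma>" and ec: "edge_connected 3 \<Gamma>" and P: "orientation \<Gamma> P"
  shows "inj_on (canonical_flow \<Gamma> P) (darts \<Gamma>)"
proof (rule inj_onI)
  fix x y assume x: "x \<in> darts \<Gamma>" and y: "y \<in> darts \<Gamma>"
    and eq: "canonical_flow \<Gamma> P x = canonical_flow \<Gamma> P y"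
  let ?F = "free_Abelian_group P" and ?I = "initial_vertex \<Gamma>" and ?r = "rev_dart \<Gamma>"
  interpret F: comm_group ?F by (rule abelian_free_Abelian_group)
  have "dart_elem \<Gamma> P x \<in> jac_subgroup \<Gamma> P #>\<^bsub>?F\<^esub> dart_elem \<Gamma> P y"
    using F.rcos_self[OF dart_elem_in_carrier[OF P x] normal_imp_subgroup[OF normal_jac_subgroup[OF P]]]
      eq by (simp add: canonical_flow_def)
  then obtain n where n: "n \<in> jac_subgroup \<Gamma> P" "dart_elem \<Gamma> P x = n + dart_elem \<Gamma> P y"
    by (auto simp: r_coset_def)
  obtain \<phi> where \<phi>: "\<And>v. boundary \<Gamma> P n v = laplacian \<Gamma> \<phi> v"
    using boundary_jac_subgroup[OF P n(1)] by blast
  have lap: "laplacian \<Gamma> \<phi> v = of_bool (?I x = v) - of_bool (?I (?r x) = v)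
      - of_bool (?I y = v) + of_bool (?I (?r y) = v)" for v
    using \<phi>[of v] boundary_add[of \<Gamma> P n "dart_elem \<Gamma> P y" v]
      boundary_dart_elem[OF P x, of v] boundary_dart_elem[OF P y, of v] n(2) by simp
  have V: "?I z \<in> vertices \<Gamma>" "?I (?r z) \<in> vertices \<Gamma>" if "z \<in> darts \<Gamma>" for z
    using that by (simp_all add: initial_vertex_in_vertices rev_dart_closed)
  define M where "M = Max (\<phi> ` vertices \<Gamma>)"
  define A where "A = {v \<in> vertices \<Gamma>. \<phi> v = M}"
  have max: "\<phi> v \<le> M" if "v \<in> vertices \<Gamma>" for v
    unfolding M_def using finite_vertices that by (intro Max_ge) auto
  have "M \<in> \<phi> ` vertices \<Gamma>"
    unfolding M_def using finite_vertices V[OF x] by (intro Max_in) auto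
  then obtain a where a: "a \<in> A" unfolding A_def by blast
  have all: "u \<in> A" if u: "u \<in> vertices \<Gamma>" for u
  proof (rule ccontr)
    assume "u \<notin> A"
    \<comment> \<open>The vertex \<open>u\<close> outside \<open>A\<close> makes the cut proper, so
      3-edge-connectivity bounds the sum from below. Only two terms of its explicit form are
      positive, which gives the contradiction.\<close>
    then have "3 \<le> (\<Sum>v\<in>A. laplacian \<Gamma> \<phi> v)"
      using edge_cut_ge[OF ec _ a u] sum_laplacian_maxima_ge[OF max A_def] by (force simp: A_def)
    also have "\<dots> = of_bool (?I x \<in> A) - of_bool (?I (?r x) \<in> A) - of_bool (?I y \<in> A) + of_bool (?I (?r y) \<in> A)"
      using finite_vertices unfolding lap sum.distrib sum_subtractf
      by (simp add: of_bool_def A_def)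
    finally show False by (simp add: of_bool_def split: if_splits)
  qed
  have "laplacian \<Gamma> \<phi> v = 0" for v
    unfolding laplacian_def using all[OF V(1)] all[OF V(2)] by (simp add: A_def)
  note zero = lap[unfolded this]
  have no_loop: "?I (?r z) \<noteq> ?I z" if "z \<in> darts \<Gamma>" for z
    using simp that by (auto simp: simple_graph_def loop_def)
  \<comment> \<open>At the initial vertex of \<open>x\<close>, where the reverse of \<open>x\<close>
    does not start, the term +1 can be cancelled only by \<open>y\<close> starting there; at the
    terminal vertex of \<open>x\<close> the term -1 can be cancelled only by \<open>y\<close> ending
    there.\<close>
  have "?I y = ?I x" "?I (?r y) = ?I (?r x)"
    using zero[of "?I x"] zero[of "?I (?r x)"] no_loop[OF x] no_loop[OF x, symmetric]
    by (auto simp: of_bool_def split: if_splits)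
  moreover from this have "edge_of \<Gamma> x = edge_of \<Gamma> y"
    using simp x y unfolding simple_graph_def parallel_def by metis
  \<comment> \<open>Two darts of one edge that start at the same vertex coincide, since otherwise
    the edge would be a loop.\<close>
  ultimately show "x = y"
    using no_loop[OF x] by (auto simp: edge_of_def doubleton_eq_iff)
qed

end

section \<open>Isomorphism between a group of automorphisms and its image\<close>

theorem theorem4p3:
  fixes \<Gamma> :: "'a dart_graph"
    and P :: "'a set"
    and \<xi> :: "'a \<Rightarrow> ('a \<Rightarrow>\<^sub>0 int) set"
    and G :: "('a \<Rightarrow> 'a) set"
  assumes "dart_graph \<Gamma>"
    and "simple_graph \<Gamma>"
    and "connected_graph \<Gamma>"
    and "edge_connected 3 \<Gamma>"
    and "orientation \<Gamma> P"
    and "harmonic_flow \<Gamma> (Jac \<Gamma> P) \<xi>"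
    and "subgroup G (GraphAutoGroup \<Gamma>)"
    and "semiregular (GraphAutoGroup \<Gamma> \<lparr>carrier := G\<rparr>) (darts \<Gamma>) dart_action"
    and "semiregular (GraphAutoGroup \<Gamma> \<lparr>carrier := G\<rparr>) (vertices \<Gamma>) (vertex_action \<Gamma>)"
  shows "subgroup (Theta \<Gamma> (Jac \<Gamma> P) \<xi> ` G) (AutoGroup (Jac \<Gamma> P)) \<and>
    AutoGroup (Jac \<Gamma> P) \<lparr>carrier := Theta \<Gamma> (Jac \<Gamma> P) \<xi> ` G\<rparr> \<cong> GraphAutoGroup \<Gamma> \<lparr>carrier := G\<rparr>"
proof -
  let ?T = "Theta \<Gamma> (Jac \<Gamma> P) \<xi>"
  let ?H = "GraphAutoGroup \<Gamma> \<lparr>carrier := G\<rparr>"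
  interpret dart_graph \<Gamma> by fact
  interpret jacobian_flow \<Gamma> P \<xi>
    by unfold_locales (use assms in \<open>auto simp: simple_graph_def\<close>)
  interpret Gr: group "GraphAutoGroup \<Gamma>" by (rule group_GraphAutoGroup)
  interpret Au: group "AutoGroup (Jac \<Gamma> P)" by (rule J.AutoGroup)
  interpret T: group_hom "GraphAutoGroup \<Gamma>" "AutoGroup (Jac \<Gamma> P)" ?T
    by unfold_locales (rule Theta_hom)
  \<comment> \<open>Injectivity on darts is known for the canonical flow; the isomorphism
    \<open>h\<close> transfers it to the given \<open>\<xi>\<close>.\<close>
  obtain h where "h \<in> iso (Jac \<Gamma> P) (Jac \<Gamma> P)"
    and h: "\<And>x. x \<in> darts \<Gamma> \<Longrightarrow> h (canonical_flow \<Gamma> P x) = \<xi> x"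
    using harmonic_flow_factors_iso[OF harm] by blast
  then have "inj_on h (carrier (Jac \<Gamma> P))"
    by (simp add: iso_def bij_betw_def)
  moreover have "canonical_flow \<Gamma> P ` darts \<Gamma> \<subseteq> carrier (Jac \<Gamma> P)"
    using harmonic_canonical_flow[OF orient no_semiedge] by (auto simp: harmonic_flow_def flow_def)
  ultimately have "inj_on h (canonical_flow \<Gamma> P ` darts \<Gamma>)"
    by (rule inj_on_subset)
  then have "inj_on (h \<circ> canonical_flow \<Gamma> P) (darts \<Gamma>)"
    using inj_on_canonical_flow[OF assms(2,4,5)] by (intro comp_inj_on)
  then have "inj_on \<xi> (darts \<Gamma>)"
    using h by (simp cong: inj_on_cong)
  moreover have G: "G \<subseteq> graph_auto \<Gamma>"
    using subgroup.subset[OF assms(7)] by (simp add: GraphAutoGroup_def)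
  ultimately have inj: "inj_on ?T G"
    using Theta_inj_on inj_on_subset by blast
  have sub: "subgroup (?T ` G) (AutoGroup (Jac \<Gamma> P))"
    by (rule T.subgroup_img_is_subgroup[OF assms(7)])
  \<comment> \<open>The isomorphism is built from \<open>G\<close> onto its image, the direction in
    which it is a restriction of \<open>Theta\<close>; symmetry then gives the orientation
    claimed.\<close>
  have "?T \<in> iso ?H (AutoGroup (Jac \<Gamma> P) \<lparr>carrier := ?T ` G\<rparr>)"
    using inj T.hom_mult subgroup.mem_carrier[OF assms(7)]
    by (auto simp: iso_def hom_def bij_betw_def)
  then have "?H \<cong> AutoGroup (Jac \<Gamma> P) \<lparr>carrier := ?T ` G\<rparr>"
    by (rule is_isoI)
  then show ?thesis
    using sub group.iso_sym[OF Gr.subgroup_imp_group[OF assms(7)]] by blast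
qed

end
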